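(* Let $W=(W_t)_{t\ge0}$ be a standard Brownian motion and let $f:\mathbb{R}\to\mathbb{R}$. The following assertions are equivalent: (i) $f$ is a measurable, strictly positive solution of the D'Alembert functional equation $f(x+y)+f(x-y)=2f(x)f(y)$ for all $x,y\in\mathbb{R}$; (ii) $f$ is a strictly positive even function with $f(0)=1$ such that $f(W_t)$ is integrable for every $t\ge0$ and the process $N_t=\dfrac{f(W_t)}{E f(W_t)}$, $t\ge0$, is a right-continuous martingale; (iii) $f(x)=\cosh(\lambda x)=\tfrac12\big(e^{\lambda x}+e^{-\lambda x}\big)$ for all $x\in\mathbb{R}$, for some constant $\lambda\in\mathbb{R}$.
   Context: $W$ is a standard Brownian motion on a complete probability space $(\Omega,\mathcal{F},P)$, and $(\mathcal{F}_t)_{t\ge0}$ is the filtration generated by $W$; "martingale" means martingale with respect to this filtration. *)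

theory Defs
  imports "HOL-Probability.Probability"
begin

text \<open>Standard Brownian motion W on the probability space M, indexed by t \<ge> 0
  (values of W at negative times are irrelevant).\<close>
definition brownian_motion :: "'a measure \<Rightarrow> (real \<Rightarrow> 'a \<Rightarrow> real) \<Rightarrow> bool" where
  "brownian_motion M W \<longleftrightarrow>
     (\<forall>t\<ge>0. W t \<in> borel_measurable M) \<and>
     (AE \<omega> in M. W 0 \<omega> = 0) \<and>
     (AE \<omega> in M. continuous_on {0..} (\<lambda>t. W t \<omega>)) \<and>
     (\<forall>s t. 0 \<le> s \<longrightarrow> s < t \<longrightarrow>
        distributed M lborel (\<lambda>\<omega>. W t \<omega> - W s \<omega>)
          (\<lambda>x. ennreal (normal_density 0 (sqrt (t - s)) x))) \<and>
     (\<forall>(n::nat) (\<tau>::nat \<Rightarrow> real). 0 \<le> \<tau> 0 \<longrightarrow> (\<forall>i<n. \<tau> i \<le> \<tau> (Suc i)) \<longrightarrow>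
        prob_space.indep_vars M (\<lambda>_. borel) (\<lambda>i \<omega>. W (\<tau> (Suc i)) \<omega> - W (\<tau> i) \<omega>) {..<n})"

definition complete_space_measure :: "'a measure \<Rightarrow> bool" where
  "complete_space_measure M \<longleftrightarrow> (\<forall>A B. B \<in> null_sets M \<longrightarrow> A \<subseteq> B \<longrightarrow> A \<in> sets M)"

definition natural_filtration :: "'a measure \<Rightarrow> (real \<Rightarrow> 'a \<Rightarrow> real) \<Rightarrow> real \<Rightarrow> 'a measure" where
  "natural_filtration M W t =
     sigma (space M) (\<Union>s\<in>{0..t}. {W s -` A \<inter> space M | A. A \<in> sets borel})"

definition martingale :: "'a measure \<Rightarrow> (real \<Rightarrow> 'a measure) \<Rightarrow> (real \<Rightarrow> 'a \<Rightarrow> real) \<Rightarrow> bool" where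
  "martingale M F X \<longleftrightarrow>
     (\<forall>t\<ge>0. subalgebra M (F t)) \<and>
     (\<forall>s t. 0 \<le> s \<longrightarrow> s \<le> t \<longrightarrow> sets (F s) \<subseteq> sets (F t)) \<and>
     (\<forall>t\<ge>0. X t \<in> borel_measurable (F t)) \<and>
     (\<forall>t\<ge>0. integrable M (X t)) \<and>
     (\<forall>s t. 0 \<le> s \<longrightarrow> s \<le> t \<longrightarrow> (AE \<omega> in M. real_cond_exp M (F s) (X t) \<omega> = X s \<omega>))"

definition right_continuous_process :: "'a measure \<Rightarrow> (real \<Rightarrow> 'a \<Rightarrow> real) \<Rightarrow> bool" where
  "right_continuous_process M X \<longleftrightarrow>
     (AE \<omega> in M. \<forall>t\<ge>0. continuous (at_right t) (\<lambda>s. X s \<omega>))"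

end

(* The delicate implication is from the martingale to cosh, because f is not assumed to be
   measurable.  Take four independent copies w1, w2, w3, w4 of the Brownian path.  By a second
   moment estimate there are, with positive probability, times t and r in [1,2] with
   w1(t) = x, w2(t) = w3(r) and w4(r) = 0.  Writing N1, ..., N4 for the corresponding copies of N,
   the factors E f(W_t), E f(W_r) and the value of f at the common point cancel and
     f(x) = N1(t)/N2(t) * N3(r)/N4(r).
   Right-continuity of N makes the right-hand side, at the first such times, jointly measurable in
   x and the paths, so f is Borel.

   The martingale property then says that f is almost everywhere an eigenfunction of every heat
   operator, hence agrees almost everywhere with a continuous eigenfunction g.  A maximum principle
   compares g with a multiple of cosh on [-r,r], and right-continuity of N along paths through a
   given point x removes the exceptional null set. *)
theory Submission
  imports Defs
begin

section \<open>The functional equation\<close>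

text \<open>Why four paths and two times: the quotient N1(t)/N2(t) removes E f(W_t), whose
  regularity in t is unknown, but leaves f at w2(t). Asking for w2(t) = 0 directly would make the
  planar Brownian motion (w1, w2) hit the point (x, 0), an event of probability zero. Heuristically
  each equation costs half a time dimension: one time and two equations leave 0, whereas the two
  times and three equations of the chain leave 1/2. In the second moment this appears as decay with
  exponent 3/4 in each time lag, below the critical exponent 1. The chain is needed for every single
  x, since f has to be recovered at every point.

  The eigenvalue of the heat operator is also found without any regularity of E f(W_t): it is
  multiplicative in the time step, and square roots along the steps 2^-k suffice. That it is at
  least 1 comes from the slow decay, of order 1/sqrt n, of Gaussian densities; this excludes cosines
  and supplies the sign that the maximum principle requires.\<close>

locale dalembert =
  fixes f :: "real \<Rightarrow> real"
  assumes pos: "0 < f x"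
    and eq: "f (x + y) + f (x - y) = 2 * f x * f y"
begin

lemma zero: "f 0 = 1"
  using eq[of 0 0] pos[of 0] by simp

lemma even: "f (- x) = f x"
  using eq[of 0 x] zero by simp

lemma double: "f (2 * x) = 2 * (f x)\<^sup>2 - 1"
  using eq[of x x] zero by (simp add: power2_eq_square)

text \<open>A deficit \<open>1 - f y > 0\<close> at least doubles when y is doubled, because
  \<open>1 - f (2 * y) = 2 * (1 - f y) * (1 + f y)\<close> and \<open>f y > 0\<close>. It would
  eventually exceed 1, against positivity.\<close>

lemma ge_one: "1 \<le> f x"
proof (rule ccontr)
  assume "\<not> 1 \<le> f x"
  then have x: "f x < 1" by simp
  define d where "d = 1 - f x"
  have d: "0 < d" using x by (simp add: d_def)
  have "2 ^ n * d \<le> 1 - f (2 ^ n * x)" for n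
  proof (induction n)
    case 0
    then show ?case by (simp add: d_def)
  next
    case (Suc n)
    let ?y = "f (2 ^ n * x)"
    have y: "?y \<le> 1" using Suc d by (smt (verit) mult_nonneg_nonneg zero_le_power)
    have "1 - f (2 ^ Suc n * x) = 2 * (1 - ?y) * (1 + ?y)"
      using double[of "2 ^ n * x"] by (simp add: power2_eq_square algebra_simps)
    also have "\<dots> \<ge> 2 * (1 - ?y) * 1"
      using y pos[of "2 ^ n * x"] by (intro mult_left_mono) auto
    finally show ?case using Suc by simp
  qed
  moreover obtain n where "1 / d < 2 ^ n"
    using real_arch_pow[of 2 "1 / d"] by auto
  ultimately have "1 < 1 - f (2 ^ n * x)"
    using d by (smt (verit) divide_less_eq)
  then show False using pos[of "2 ^ n * x"] by simp
qed

text \<open>A Steinhaus argument. Some sublevel set \<open>A n\<close> fills more than 7/2 of the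
  interval [-2,2]; it and its translate by u lie in [-3,3], whose length 6 is less than 7/2 + 7/2,
  so they meet. A common point x bounds \<open>f u\<close> by
  \<open>2 * f (u + x) * f x\<close>.\<close>

lemma bounded_near_0:
  assumes meas: "f \<in> borel_measurable borel"
  obtains C where "\<And>u. \<bar>u\<bar> \<le> 1 \<Longrightarrow> f u \<le> C"
proof -
  define A where "A n = {x \<in> {-2..2}. f x \<le> real n}" for n
  have [measurable]: "A n \<in> sets borel" for n
    using meas unfolding A_def by measurable
  have "(\<lambda>n. emeasure lborel (A n)) \<longlonglongrightarrow> emeasure lborel (\<Union>n. A n)"
  proof (rule Lim_emeasure_incseq)
    show "incseq A"
      unfolding incseq_def A_def by (auto intro: order_trans)
  qed auto
  moreover have "(\<Union>n. A n) = {-2..2}"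
    using real_arch_simple by (auto simp: A_def)
  ultimately have "(\<lambda>n. emeasure lborel (A n)) \<longlonglongrightarrow> 4" by simp
  then have "\<forall>\<^sub>F n in sequentially. ennreal (7/2) < emeasure lborel (A n)"
    by (rule order_tendstoD) (simp add: ennreal_less_iff flip: ennreal_numeral)
  then obtain n where n: "ennreal (7/2) < emeasure lborel (A n)"
    by (auto simp: eventually_sequentially)
  show thesis
  proof (rule that)
    fix u :: real assume u: "\<bar>u\<bar> \<le> 1"
    let ?B = "(\<lambda>x. u + x) -` A n"
    have [measurable]: "?B \<in> sets borel"
      by (rule measurable_sets_borel[of _ borel]) auto
    have B: "emeasure lborel ?B = emeasure lborel (A n)"
      using emeasure_distr[of "\<lambda>x. u + x" lborel borel "A n"] 
      by (simp add: lborel_distr_plus)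
    have "A n \<inter> ?B \<noteq> {}"
    proof
      assume "A n \<inter> ?B = {}"
      then have "emeasure lborel (A n) + emeasure lborel ?B = emeasure lborel (A n \<union> ?B)"
        by (intro plus_emeasure) auto
      also have "\<dots> \<le> emeasure lborel {-3..3::real}"
        using u by (intro emeasure_mono) (auto simp: A_def)
      finally have "emeasure lborel (A n) + emeasure lborel (A n) \<le> 6" by (simp add: B)
      moreover have "ennreal (7/2) + ennreal (7/2) \<le> emeasure lborel (A n) + emeasure lborel (A n)"
        using n by (intro add_mono) auto
      ultimately have "ennreal (7/2) + ennreal (7/2) \<le> 6" by (rule order_trans[rotated])
      then have "ennreal 7 \<le> ennreal 6" by (simp flip: ennreal_plus)
      then show False by (subst (asm) ennreal_le_iff) auto
    qed
    then obtain x where x: "x \<in> A n" "u + x \<in> A n" by auto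
    have "f u \<le> f (u + x + x) + f (u + x - x)"
      using pos[of "u + x + x"] by simp
    also have "\<dots> = 2 * f (u + x) * f x" by (rule eq)
    also have "\<dots> \<le> 2 * real n * real n"
      using x pos[of x] pos[of "u + x"] by (intro mult_mono) (auto simp: A_def)
    finally show "f u \<le> 2 * real n * real n" .
  qed
qed

text \<open>Since \<open>f >= 1\<close>, halving the argument divides \<open>f - 1\<close> by at
  least 4; iterating this turns the bound on [-1,1] into convergence.\<close>

lemma tendsto_0:
  assumes "f \<in> borel_measurable borel"
  shows "(f \<longlongrightarrow> 1) (nhds 0)"
proof -
  obtain C where C: "\<And>u. \<bar>u\<bar> \<le> 1 \<Longrightarrow> f u \<le> C"
    using bounded_near_0[OF assms] by blast
  have half: "f x - 1 \<le> (f (2 * x) - 1) / 4" for x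
  proof -
    have "f (2 * x) - 1 = 2 * (f x - 1) * (f x + 1)"
      using double[of x] by (simp add: power2_eq_square algebra_simps)
    also have "\<dots> \<ge> 2 * (f x - 1) * 2"
      using ge_one[of x] by (intro mult_left_mono) auto
    finally show ?thesis by simp
  qed
  have bnd: "f u - 1 \<le> C / 4 ^ n" if "\<bar>u\<bar> \<le> 1 / 2 ^ n" for u n
    using that
  proof (induction n arbitrary: u)
    case 0
    then show ?case using C[of u] by simp
  next
    case (Suc n)
    then have "f (2 * u) - 1 \<le> C / 4 ^ n" by (intro Suc.IH) (simp add: field_simps abs_mult)
    then have "(f (2 * u) - 1) / 4 \<le> C / 4 ^ n / 4" by simp
    then show ?case using half[of u] by simp
  qed
  show ?thesis
  proof (rule tendstoI)
    fix e :: real assume e: "0 < e"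
    have "(\<lambda>n. C / 4 ^ n) \<longlonglongrightarrow> 0" by real_asymp
    then have "\<forall>\<^sub>F n in sequentially. C / 4 ^ n < e" using e by (rule order_tendstoD)
    then obtain n where n: "C / 4 ^ n < e" by (auto simp: eventually_sequentially)
    have "\<forall>\<^sub>F u in nhds 0. dist u 0 < 1 / 2 ^ n"
      by (intro eventually_nhds_metric[THEN iffD2] exI[of _ "1 / 2 ^ n"]) auto
    then show "\<forall>\<^sub>F u in nhds 0. dist (f u) 1 < e"
    proof (rule eventually_mono)
      fix u :: real assume "dist u 0 < 1 / 2 ^ n"
      then have "f u - 1 \<le> C / 4 ^ n" by (intro bnd) (simp add: dist_real_def)
      then show "dist (f u) 1 < e" using n ge_one[of u] by (simp add: dist_real_def)
    qed
  qed
qed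

text \<open>The half sum of \<open>f (x + h)\<close> and \<open>f (x - h)\<close> is
  \<open>f x * f h\<close>, and the square of their difference is
  \<open>4 * ((f x)^2 - 1) * ((f h)^2 - 1)\<close>. Continuity at 0 controls both as h tends to
  0.\<close>

lemma continuous:
  assumes "f \<in> borel_measurable borel"
  shows "isCont f x"
proof -
  have t0: "(f \<longlongrightarrow> 1) (at 0)"
    using tendsto_0[OF assms] by (rule filterlim_mono) (auto simp: at_within_le_nhds)
  have sq: "(f (x + h) - f (x - h))\<^sup>2 = 4 * ((f x)\<^sup>2 - 1) * ((f h)\<^sup>2 - 1)" for h
  proof -
    have "(f (x + h) - f (x - h))\<^sup>2 = (f (x + h) + f (x - h))\<^sup>2 - 2 * (2 * f (x + h) * f (x - h))"
      by (simp add: power2_eq_square algebra_simps)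
    also have "2 * f (x + h) * f (x - h) = f (2 * x) + f (2 * h)"
      using eq[of "x + h" "x - h"] by simp
    finally show ?thesis
      unfolding eq double by (simp add: power2_eq_square algebra_simps)
  qed
  have "((\<lambda>h. 4 * ((f x)\<^sup>2 - 1) * ((f h)\<^sup>2 - 1)) \<longlongrightarrow> 4 * ((f x)\<^sup>2 - 1) * (1\<^sup>2 - 1)) (at 0)"
    by (intro tendsto_intros t0)
  then have "((\<lambda>h. \<bar>f (x + h) - f (x - h)\<bar>) \<longlongrightarrow> sqrt 0) (at 0)"
    unfolding sq[symmetric] by (subst real_sqrt_abs[symmetric], intro tendsto_real_sqrt) simp
  then have d: "((\<lambda>h. f (x + h) - f (x - h)) \<longlongrightarrow> 0) (at 0)"
    by (simp add: tendsto_rabs_zero_iff)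
  have "((\<lambda>h. f x * f h + (f (x + h) - f (x - h)) / 2) \<longlongrightarrow> f x * 1 + 0 / 2) (at 0)"
    by (intro tendsto_intros t0 d) auto
  moreover have "f x * f h + (f (x + h) - f (x - h)) / 2 = f (x + h)" for h
    using eq[of x h] by (simp add: field_simps)
  ultimately show ?thesis by (simp add: isCont_iff)
qed

text \<open>Along the multiples of d both sides obey the recursion a(k+2) = 2 a(1) a(k+1) - a(k)
  with the same first two values.\<close>

lemma eq_cosh_multiples:
  assumes "f d = cosh (c * d)"
  shows "f (real k * d) = cosh (c * (real k * d))"
proof (induction k rule: nat_less_induct)
  case (1 k)
  consider "k = 0" | "k = 1" | j where "k = Suc (Suc j)"
    by (metis One_nat_def not0_implies_Suc)
  then show ?case
  proof cases
    case (3 j)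
    have cosh: "cosh (a + b) + cosh (a - b) = 2 * cosh a * cosh b" for a b :: real
      by (simp add: cosh_add cosh_diff)
    have "f (real k * d) = 2 * f (real (Suc j) * d) * f d - f (real j * d)"
      using eq[of "real (Suc j) * d" d] 3 by (simp add: algebra_simps)
    also have "\<dots> = 2 * cosh (c * (real (Suc j) * d)) * cosh (c * d) - cosh (c * (real j * d))"
      using 1[rule_format, of "Suc j"] 1[rule_format, of j] 3 assms by (simp only:)
    also have "\<dots> = cosh (c * (real k * d))"
      using cosh[of "c * (real (Suc j) * d)" "c * d"] 3 by (simp add: algebra_simps)
    finally show ?thesis .
  qed (use assms zero in auto)
qed

text \<open>One value fixes c. The half-angle formula, with positive square roots, carries the
  identity to 2^-n, the recursion to all dyadic points, and continuity with evenness to the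
  line.\<close>

lemma eq_cosh:
  assumes meas: "f \<in> borel_measurable borel"
  shows "\<exists>c. \<forall>x. f x = cosh (c * x)"
proof -
  \<comment> \<open>\<open>ge_one\<close> makes \<open>f 1\<close> a value of cosh.\<close>
  define c where "c = arcosh (f 1)"
  have half: "f (1 / 2 ^ n) = cosh (c * (1 / 2 ^ n))" for n
  proof (induction n)
    case 0
    then show ?case using ge_one[of 1] by (simp add: c_def)
  next
    case (Suc n)
    let ?h = "1 / 2 ^ Suc n :: real"
    have "2 * (f ?h)\<^sup>2 - 1 = cosh (2 * (c * ?h))"
    proof -
      have "2 * (c * ?h) = c * (1 / 2 ^ n)" "2 * ?h = 1 / 2 ^ n" by simp_all
      then show ?thesis using Suc double[of ?h] by (simp only:)
    qed
    also have "\<dots> = 2 * (cosh (c * ?h))\<^sup>2 - 1"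
      by (rule cosh_double_cosh)
    finally have "(f ?h)\<^sup>2 = (cosh (c * ?h))\<^sup>2" by simp
    then show ?case by (rule power2_eq_imp_eq) (use pos[of ?h] in simp_all)
  qed
  have nonneg: "f x = cosh (c * x)" if x: "0 \<le> x" for x
  proof -
    \<comment> \<open>Dyadic approximation of x from below, written as a natural multiple of 2^-n so
      that \<open>eq_cosh_multiples\<close> applies.\<close>
    define y where "y n = real (nat \<lfloor>2 ^ n * x\<rfloor>) * (1 / 2 ^ n)" for n
    have y: "y \<longlonglongrightarrow> x"
    proof (rule tendsto_sandwich)
      show "(\<lambda>n. x - 1 / 2 ^ n) \<longlonglongrightarrow> x" by real_asymp
      show "\<forall>\<^sub>F n in sequentially. x - 1 / 2 ^ n \<le> y n"
      proof (rule always_eventually, rule)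
        fix n :: nat
        have "2 ^ n * x - 1 \<le> real (nat \<lfloor>2 ^ n * x\<rfloor>)" using x by linarith
        then have "(2 ^ n * x - 1) * (1 / 2 ^ n) \<le> y n"
          unfolding y_def by (intro mult_right_mono) auto
        moreover have "(2 ^ n * x - 1) * (1 / 2 ^ n) = x - 1 / 2 ^ n" by (simp add: field_simps)
        ultimately show "x - 1 / 2 ^ n \<le> y n" by (simp only:)
      qed
      show "\<forall>\<^sub>F n in sequentially. y n \<le> x"
        using x by (intro always_eventually) (simp add: y_def field_simps)
    qed simp
    have "(\<lambda>n. f (y n)) \<longlonglongrightarrow> f x"
      using continuous[OF meas] y by (rule isCont_tendsto_compose)
    moreover have "(\<lambda>n. f (y n)) \<longlonglongrightarrow> cosh (c * x)"
    proof -
      have "f (y n) = cosh (c * y n)" for n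
        unfolding y_def by (rule eq_cosh_multiples[OF half])
      then show ?thesis by (simp only:) (intro tendsto_intros y)
    qed
    ultimately show ?thesis by (rule LIMSEQ_unique)
  qed
  have "f x = cosh (c * x)" for x
    using nonneg[of x] nonneg[of "-x"] even[of x] by (cases "0 \<le> x") auto
  then show ?thesis by blast
qed

end

lemma dalembert_iff_cosh:
  fixes f :: "real \<Rightarrow> real"
  shows "(f \<in> borel_measurable borel \<and> (\<forall>x. 0 < f x) \<and>
        (\<forall>x y. f (x + y) + f (x - y) = 2 * f x * f y)) \<longleftrightarrow> (\<exists>c. \<forall>x. f x = cosh (c * x))"
    (is "?L \<longleftrightarrow> ?R")
proof
  assume ?L
  then interpret dalembert f by unfold_locales auto
  show ?R using \<open>?L\<close> eq_cosh by blast
next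
  assume ?R
  then obtain c where "f = (\<lambda>x. cosh (c * x))" by auto
  then show ?L
    by (auto simp: cosh_real_pos cosh_add cosh_diff algebra_simps
        intro!: borel_measurable_continuous_onI continuous_intros)
qed

section \<open>Independence of the past and the increments\<close>

locale brownian = prob_space M for M :: "'a measure" +
  fixes W :: "real \<Rightarrow> 'a \<Rightarrow> real"
  assumes bm: "brownian_motion M W"
begin

abbreviation "\<F> \<equiv> natural_filtration M W"

lemma W_measurable [measurable]: "0 \<le> t \<Longrightarrow> W t \<in> borel_measurable M"
  using bm by (simp add: brownian_motion_def)

lemma AE_W_0: "AE \<omega> in M. W 0 \<omega> = 0"
  using bm by (simp add: brownian_motion_def)

lemma AE_continuous: "AE \<omega> in M. continuous_on {0..} (\<lambda>t. W t \<omega>)"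
  using bm by (simp add: brownian_motion_def)

lemma distributed_increment:
  "0 \<le> s \<Longrightarrow> s < t \<Longrightarrow>
    distributed M lborel (\<lambda>\<omega>. W t \<omega> - W s \<omega>) (\<lambda>x. ennreal (normal_density 0 (sqrt (t - s)) x))"
  using bm by (simp add: brownian_motion_def)

lemma distributed_W:
  assumes "0 < t"
  shows "distributed M lborel (W t) (\<lambda>x. ennreal (normal_density 0 (sqrt t) x))"
proof -
  have "distr M lborel (W t) = distr M lborel (\<lambda>\<omega>. W t \<omega> - W 0 \<omega>)"
    using AE_W_0 assms by (intro distr_cong_AE) auto
  then show ?thesis
    using distributed_increment[of 0 t] assms by (simp add: distributed_def)
qed

lemma sets_\<F>:
  "sets (\<F> s) = sigma_sets (space M) (\<Union>u\<in>{0..s}. {W u -` A \<inter> space M | A. A \<in> sets borel})"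
  unfolding natural_filtration_def by (rule sets_measure_of) auto

lemma space_\<F> [simp]: "space (\<F> s) = space M"
  unfolding natural_filtration_def by (rule space_measure_of) auto

lemma subalgebra_\<F>: "subalgebra M (\<F> s)"
  unfolding subalgebra_def sets_\<F> by (auto intro!: sets.sigma_sets_subset)

lemma \<F>_mono: "s \<le> t \<Longrightarrow> sets (\<F> s) \<subseteq> sets (\<F> t)"
  unfolding sets_\<F> by (intro sigma_sets_mono') fastforce

lemma W_measurable_\<F>: "0 \<le> u \<Longrightarrow> u \<le> s \<Longrightarrow> W u \<in> borel_measurable (\<F> s)"
  by (rule measurableI) (fastforce simp: sets_\<F> intro!: sigma_sets.Basic)+

text \<open>Almost surely \<open>W 0 = 0\<close>, so the values of W on J are partial sums of
  increments over consecutive points of J; these all end by time s and are jointly independent of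
  the increment from s to t.\<close>

lemma prob_cylinder_increment:
  assumes s: "0 \<le> s" "s \<le> t" and J: "finite J" "J \<subseteq> {0..s}"
    and A: "\<And>u. A u \<in> sets borel" and B: "B \<in> sets borel"
  shows "prob ({\<omega> \<in> space M. \<forall>u\<in>J. W u \<omega> \<in> A u} \<inter> {\<omega> \<in> space M. W t \<omega> - W s \<omega> \<in> B}) =
    prob {\<omega> \<in> space M. \<forall>u\<in>J. W u \<omega> \<in> A u} * prob {\<omega> \<in> space M. W t \<omega> - W s \<omega> \<in> B}"
proof -
  note A [measurable] B [measurable]
  define xs where "xs = sorted_list_of_set J"
  define n where "n = length xs"
  \<comment> \<open>The times are 0, the n sorted points of J, then s, then t. Thus
    \<open>D (Suc n)\<close> is the increment from s to t, and \<open>D n\<close> fills the gap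
    between the last point of J and s.\<close>
  define \<tau> where "\<tau> i = (if i = 0 then 0 else if i \<le> n then xs ! (i - 1) else if i = Suc n then s else t)"
    for i
  have xs: "set xs = J" "sorted xs" using J by (auto simp: xs_def)
  have xs_nth: "0 \<le> xs ! k" "xs ! k \<le> s" if "k < n" for k
    using that xs(1) J nth_mem[of k xs] by (auto simp: n_def)
  have \<tau>_mono: "\<tau> i \<le> \<tau> (Suc i)" for i
    using s xs_nth sorted_nth_mono[OF xs(2), of "i - 1" i] by (auto simp: \<tau>_def n_def)
  have \<tau>_nonneg: "0 \<le> \<tau> i" for i
    using s xs_nth by (auto simp: \<tau>_def)
  define D where "D i \<omega> = W (\<tau> (Suc i)) \<omega> - W (\<tau> i) \<omega>" for i \<omega>
  have "\<And>(n::nat) (\<tau>::nat \<Rightarrow> real). 0 \<le> \<tau> 0 \<Longrightarrow> (\<forall>i<n. \<tau> i \<le> \<tau> (Suc i)) \<Longrightarrow>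
      indep_vars (\<lambda>_. borel) (\<lambda>i \<omega>. W (\<tau> (Suc i)) \<omega> - W (\<tau> i) \<omega>) {..<n}"
    using bm by (simp add: brownian_motion_def)
  then have "indep_vars (\<lambda>_. borel) D {..<Suc (Suc n)}"
    unfolding D_def using \<tau>_mono \<tau>_nonneg by blast
  then have ind: "indep_var (PiM {..n} (\<lambda>_. borel)) (\<lambda>\<omega>. restrict (\<lambda>i. D i \<omega>) {..n})
      (PiM {Suc n} (\<lambda>_. borel)) (\<lambda>\<omega>. restrict (\<lambda>i. D i \<omega>) {Suc n})"
    by (rule indep_var_restrict) auto
  define S1 where "S1 = {g \<in> space (PiM {..n} (\<lambda>_. borel :: real measure)). \<forall>k\<in>{..<n}. (\<Sum>i<Suc k. g i) \<in> A (xs ! k)}"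
  define S2 where "S2 = {g \<in> space (PiM {Suc n} (\<lambda>_. borel :: real measure)). g (Suc n) \<in> B}"
  have [measurable]: "(\<lambda>g. \<Sum>i<Suc k. g i) \<in> borel_measurable (PiM {..n} (\<lambda>_. borel :: real measure))"
    if "k \<in> {..<n}" for k
    using that by (intro borel_measurable_sum measurable_component_singleton) auto
  have S1: "S1 \<in> sets (PiM {..n} (\<lambda>_. borel))"
    unfolding S1_def by measurable
  have S2: "S2 \<in> sets (PiM {Suc n} (\<lambda>_. borel))"
    unfolding S2_def by measurable
  have [measurable]: "D i \<in> borel_measurable M" for i
    unfolding D_def using \<tau>_nonneg by measurable
  have [measurable]: "W s \<in> borel_measurable M" "W t \<in> borel_measurable M"
    using s by auto
  define E where "E = {\<omega> \<in> space M. \<forall>k\<in>{..<n}. (\<Sum>i<Suc k. D i \<omega>) \<in> A (xs ! k)}"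
  define I where "I = {\<omega> \<in> space M. W t \<omega> - W s \<omega> \<in> B}"
  define C where "C = {\<omega> \<in> space M. \<forall>u\<in>J. W u \<omega> \<in> A u}"
  have [measurable]: "E \<in> events" "I \<in> events"
    unfolding E_def I_def by measurable
  have [measurable]: "C \<in> events"
    unfolding C_def
  proof (rule sets.sets_Collect_finite_All)
    fix u assume "u \<in> J"
    then have [measurable]: "W u \<in> borel_measurable M" using J by auto
    show "{\<omega> \<in> space M. W u \<omega> \<in> A u} \<in> events" by measurable
  qed (use J in auto)
  have DI: "D (Suc n) = (\<lambda>\<omega>. W t \<omega> - W s \<omega>)"
    by (auto simp: D_def \<tau>_def)
  have 1: "(\<lambda>x. (\<lambda>i\<in>{..n}. D i x, \<lambda>i\<in>{Suc n}. D i x)) -` (S1 \<times> S2) \<inter> space M = E \<inter> I"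
    by (auto simp: S1_def S2_def E_def I_def space_PiM DI)
  have 2: "(\<lambda>x. (\<lambda>i\<in>{..n}. D i x)) -` S1 \<inter> space M = E"
    by (auto simp: S1_def E_def space_PiM)
  have 3: "(\<lambda>x. (\<lambda>i\<in>{Suc n}. D i x)) -` S2 \<inter> space M = I"
    by (auto simp: S2_def I_def space_PiM DI)
  have prod: "prob (E \<inter> I) = prob E * prob I"
    using indep_varD[OF ind S1 S2] unfolding 1 2 3 .
  have ae: "AE \<omega> in M. \<omega> \<in> C \<longleftrightarrow> \<omega> \<in> E"
    using AE_W_0
  proof eventually_elim
    fix \<omega> assume "W 0 \<omega> = 0"
    then have sum: "(\<Sum>i<Suc k. D i \<omega>) = W (xs ! k) \<omega>" if "k < n" for k
    proof -
      have "(\<Sum>i<Suc k. D i \<omega>) = W (\<tau> (Suc k)) \<omega> - W (\<tau> 0) \<omega>"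
        unfolding D_def by (rule sum_lessThan_telescope)
      then show ?thesis using that \<open>W 0 \<omega> = 0\<close> by (simp add: \<tau>_def del: sum.lessThan_Suc)
    qed
    have "(\<forall>u\<in>J. W u \<omega> \<in> A u) \<longleftrightarrow> (\<forall>k<n. W (xs ! k) \<omega> \<in> A (xs ! k))"
      unfolding xs(1)[symmetric] n_def by (metis in_set_conv_nth)
    then show "\<omega> \<in> C \<longleftrightarrow> \<omega> \<in> E"
      using sum by (auto simp: C_def E_def simp del: sum.lessThan_Suc)
  qed
  then have "prob C = prob E" "prob (C \<inter> I) = prob (E \<inter> I)"
    by (auto intro!: finite_measure_eq_AE)
  then show ?thesis
    using prod unfolding C_def I_def by simp
qed

text \<open>Finite-dimensional cylinders form an intersection-stable generator of the past, so the
  product rule for cylinders extends to the generated sigma-algebra.\<close>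

lemma indep_past_increment:
  assumes s: "0 \<le> s" "s \<le> t"
  shows "indep_set (sets (\<F> s))
    (sigma_sets (space M) {(\<lambda>\<omega>. W t \<omega> - W s \<omega>) -` B \<inter> space M | B. B \<in> sets borel})"
proof -
  define cyl where "cyl = {{\<omega> \<in> space M. \<forall>u\<in>J. W u \<omega> \<in> A u} | J A. finite J \<and> J \<subseteq> {0..s} \<and> (\<forall>u. A u \<in> sets borel)}"
  define G where "G = {(\<lambda>\<omega>. W t \<omega> - W s \<omega>) -` B \<inter> space M | B. B \<in> sets borel}"
  have "Int_stable cyl"
  proof (rule Int_stableI)
    fix a b assume "a \<in> cyl" "b \<in> cyl"
    then obtain J A J' A' where
      a: "a = {\<omega> \<in> space M. \<forall>u\<in>J. W u \<omega> \<in> A u}" "finite J" "J \<subseteq> {0..s}" "\<And>u. A u \<in> sets borel" and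
      b: "b = {\<omega> \<in> space M. \<forall>u\<in>J'. W u \<omega> \<in> A' u}" "finite J'" "J' \<subseteq> {0..s}" "\<And>u. A' u \<in> sets borel"
      unfolding cyl_def by blast
    \<comment> \<open>Padding with \<open>UNIV\<close> expresses both cylinders over the common
      index set \<open>J \<union> J'\<close>.\<close>
    let ?A = "\<lambda>u. (if u \<in> J then A u else UNIV) \<inter> (if u \<in> J' then A' u else UNIV)"
    have "a \<inter> b = {\<omega> \<in> space M. \<forall>u\<in>J \<union> J'. W u \<omega> \<in> ?A u}"
      unfolding a(1) b(1) by (auto split: if_splits)
    moreover have "?A u \<in> sets borel" for u using a b by auto
    ultimately show "a \<inter> b \<in> cyl"
      unfolding cyl_def using a b by (intro CollectI exI[of _ "J \<union> J'"] exI[of _ ?A]) auto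
  qed
  moreover have "Int_stable G"
  proof (rule Int_stableI)
    fix a b assume "a \<in> G" "b \<in> G"
    then obtain A B where "a = (\<lambda>\<omega>. W t \<omega> - W s \<omega>) -` A \<inter> space M" "b = (\<lambda>\<omega>. W t \<omega> - W s \<omega>) -` B \<inter> space M"
      and "A \<in> sets borel" "B \<in> sets borel" unfolding G_def by blast
    then show "a \<inter> b \<in> G" unfolding G_def by (intro CollectI exI[of _ "A \<inter> B"]) auto
  qed
  moreover have "indep_set cyl G"
  proof (rule indep_setI)
    show "cyl \<subseteq> events"
    proof
      fix a assume "a \<in> cyl"
      then obtain J A where a: "a = {\<omega> \<in> space M. \<forall>u\<in>J. W u \<omega> \<in> A u}" "finite J" "J \<subseteq> {0..s}" "\<And>u. A u \<in> sets borel"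
        unfolding cyl_def by blast
      show "a \<in> events"
        unfolding a(1)
      proof (rule sets.sets_Collect_finite_All)
        fix u assume "u \<in> J"
        then have [measurable]: "W u \<in> borel_measurable M" "A u \<in> sets borel" using a by auto
        show "{\<omega> \<in> space M. W u \<omega> \<in> A u} \<in> events" by measurable
      qed (use a in auto)
    qed
    show "G \<subseteq> events"
      unfolding G_def using s by (auto intro!: measurable_sets[of _ M borel])
    fix a b assume "a \<in> cyl" "b \<in> G"
    then obtain J A B where "a = {\<omega> \<in> space M. \<forall>u\<in>J. W u \<omega> \<in> A u}" "finite J" "J \<subseteq> {0..s}" "\<And>u. A u \<in> sets borel"
      "b = {\<omega> \<in> space M. W t \<omega> - W s \<omega> \<in> B}" "B \<in> sets borel"
      unfolding cyl_def G_def vimage_def by auto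
    then show "prob (a \<inter> b) = prob a * prob b"
      using prob_cylinder_increment[OF s] by blast
  qed
  ultimately have *: "indep_set (sigma_sets (space M) cyl) (sigma_sets (space M) G)"
    by (intro indep_set_sigma_sets)
  have "sets (\<F> s) \<subseteq> sigma_sets (space M) cyl"
    unfolding sets_\<F>
  proof (rule sigma_sets_mono, safe)
    fix u and A :: "real set" assume "u \<in> {0..s}" "A \<in> sets borel"
    then show "W u -` A \<inter> space M \<in> sigma_sets (space M) cyl"
      unfolding cyl_def by (intro sigma_sets.Basic CollectI exI[of _ "{u}"] exI[of _ "\<lambda>_. A"]) auto
  qed
  with * show ?thesis
    unfolding G_def[symmetric] indep_sets2_eq by blast
qed

lemma indep_var_past_increment:
  assumes s: "0 \<le> s" "s \<le> t" and X: "X \<in> borel_measurable (\<F> s)"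
  shows "indep_var borel X borel (\<lambda>\<omega>. W t \<omega> - W s \<omega>)"
  unfolding indep_var_eq
proof (intro conjI)
  show "X \<in> borel_measurable M"
    using measurable_from_subalg[OF subalgebra_\<F> X] .
  show "(\<lambda>\<omega>. W t \<omega> - W s \<omega>) \<in> borel_measurable M"
    using s by (intro borel_measurable_diff) auto
  have "sigma_sets (space M) {X -` A \<inter> space M |A. A \<in> sets borel} \<subseteq> sets (\<F> s)"
    using measurable_sets[OF X]
    by (subst space_\<F>[of s, symmetric], intro sets.sigma_sets_subset) auto
  then show "indep_set (sigma_sets (space M) {X -` A \<inter> space M |A. A \<in> sets borel})
     (sigma_sets (space M) {(\<lambda>\<omega>. W t \<omega> - W s \<omega>) -` A \<inter> space M |A. A \<in> sets borel})"
    using indep_past_increment[OF s] unfolding indep_sets2_eq by blast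
qed

end

section \<open>The hyperbolic cosine gives a martingale\<close>

text \<open>Completing the square: exponential tilting only shifts the mean.\<close>

lemma normal_density_times_exp:
  assumes "0 < \<sigma>"
  shows "normal_density 0 \<sigma> x * exp (c * x) = exp (c\<^sup>2 * \<sigma>\<^sup>2 / 2) * normal_density (c * \<sigma>\<^sup>2) \<sigma> x"
proof -
  have "- x\<^sup>2 / (2 * \<sigma>\<^sup>2) + c * x = c\<^sup>2 * \<sigma>\<^sup>2 / 2 + - (x - c * \<sigma>\<^sup>2)\<^sup>2 / (2 * \<sigma>\<^sup>2)"
    using assms by (simp add: field_simps power2_eq_square)
  then show ?thesis
    unfolding normal_density_def by (simp add: mult_exp_exp ac_simps)
qed

lemma has_bochner_integral_normal_exp:
  assumes "0 < \<sigma>"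
  shows "has_bochner_integral lborel (\<lambda>x. normal_density 0 \<sigma> x * exp (c * x)) (exp (c\<^sup>2 * \<sigma>\<^sup>2 / 2))"
  unfolding normal_density_times_exp[OF assms]
  using assms by (simp add: has_bochner_integral_iff)

lemma has_bochner_integral_normal_cosh:
  assumes "0 < \<sigma>"
  shows "has_bochner_integral lborel (\<lambda>x. normal_density 0 \<sigma> x * cosh (c * x)) (exp (c\<^sup>2 * \<sigma>\<^sup>2 / 2))"
proof -
  have "has_bochner_integral lborel
      (\<lambda>x. (normal_density 0 \<sigma> x * exp (c * x) + normal_density 0 \<sigma> x * exp (- c * x)) / 2)
      ((exp (c\<^sup>2 * \<sigma>\<^sup>2 / 2) + exp ((- c)\<^sup>2 * \<sigma>\<^sup>2 / 2)) / 2)"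
    using assms by (intro has_bochner_integral_divide_zero has_bochner_integral_add has_bochner_integral_normal_exp)
  then show ?thesis
    by (simp add: cosh_field_def field_simps)
qed

lemma has_bochner_integral_normal_sinh:
  assumes "0 < \<sigma>"
  shows "has_bochner_integral lborel (\<lambda>x. normal_density 0 \<sigma> x * sinh (c * x)) 0"
proof -
  have "has_bochner_integral lborel
      (\<lambda>x. (normal_density 0 \<sigma> x * exp (c * x) - normal_density 0 \<sigma> x * exp (- c * x)) / 2)
      ((exp (c\<^sup>2 * \<sigma>\<^sup>2 / 2) - exp ((- c)\<^sup>2 * \<sigma>\<^sup>2 / 2)) / 2)"
    using assms by (intro has_bochner_integral_divide_zero has_bochner_integral_diff has_bochner_integral_normal_exp)
  then show ?thesis
    by (simp add: sinh_field_def field_simps)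
qed

context brownian
begin

lemma distributed_has_bochner_integral:
  assumes "distributed M lborel X (\<lambda>x. ennreal (d x))" and [measurable]: "d \<in> borel_measurable borel" "g \<in> borel_measurable borel"
    and "\<And>x. 0 \<le> d x"
    and "has_bochner_integral lborel (\<lambda>x. d x * g x) (v :: real)"
  shows "has_bochner_integral M (\<lambda>\<omega>. g (X \<omega>)) v"
  using assms(5) distributed_integrable[OF assms(1), of g] distributed_integral[OF assms(1), of g] assms(4)
  by (auto simp: has_bochner_integral_iff)

lemma cosh_increment:
  assumes "0 \<le> s" "s \<le> t"
  shows "has_bochner_integral M (\<lambda>\<omega>. cosh (c * (W t \<omega> - W s \<omega>))) (exp (c\<^sup>2 * (t - s) / 2))"
    and "has_bochner_integral M (\<lambda>\<omega>. sinh (c * (W t \<omega> - W s \<omega>))) 0"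
proof -
  have [measurable]: "(\<lambda>x. cosh (c * x)) \<in> borel_measurable borel" "(\<lambda>x. sinh (c * x)) \<in> borel_measurable borel"
    by (auto intro!: borel_measurable_continuous_onI continuous_intros)
  consider "s = t" | "s < t" using assms by linarith
  then have "has_bochner_integral M (\<lambda>\<omega>. cosh (c * (W t \<omega> - W s \<omega>))) (exp (c\<^sup>2 * (t - s) / 2)) \<and>
      has_bochner_integral M (\<lambda>\<omega>. sinh (c * (W t \<omega> - W s \<omega>))) 0"
  proof cases
    case 1
    then show ?thesis by (auto simp: has_bochner_integral_iff prob_space)
  next
    case 2
    then have "0 < sqrt (t - s)" by simp
    from has_bochner_integral_normal_cosh[OF this, of c] has_bochner_integral_normal_sinh[OF this, of c] 2
    show ?thesis
      by (intro conjI distributed_has_bochner_integral[OF distributed_increment[OF \<open>0 \<le> s\<close> 2]]) auto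
  qed
  then show "has_bochner_integral M (\<lambda>\<omega>. cosh (c * (W t \<omega> - W s \<omega>))) (exp (c\<^sup>2 * (t - s) / 2))"
    "has_bochner_integral M (\<lambda>\<omega>. sinh (c * (W t \<omega> - W s \<omega>))) 0" by auto
qed

lemma
  assumes "0 \<le> t"
  shows integrable_cosh_W: "integrable M (\<lambda>\<omega>. cosh (c * W t \<omega>))"
    and integral_cosh_W: "(\<integral>\<omega>. cosh (c * W t \<omega>) \<partial>M) = exp (c\<^sup>2 * t / 2)"
    and integrable_sinh_W: "integrable M (\<lambda>\<omega>. sinh (c * W t \<omega>))"
proof -
  have [measurable]: "(\<lambda>x. cosh (c * x)) \<in> borel_measurable borel" "(\<lambda>x. sinh (c * x)) \<in> borel_measurable borel"
    by (auto intro!: borel_measurable_continuous_onI continuous_intros)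
  have [measurable]: "W t \<in> borel_measurable M" "W 0 \<in> borel_measurable M" using assms by auto
  have c: "AE \<omega> in M. cosh (c * W t \<omega>) = cosh (c * (W t \<omega> - W 0 \<omega>))"
    and s: "AE \<omega> in M. sinh (c * W t \<omega>) = sinh (c * (W t \<omega> - W 0 \<omega>))"
    using AE_W_0 by (eventually_elim, simp)+
  note i = cosh_increment[of 0 t c, simplified has_bochner_integral_iff]
  show "integrable M (\<lambda>\<omega>. cosh (c * W t \<omega>))"
    using i assms by (subst integrable_cong_AE[OF _ _ c]) auto
  show "(\<integral>\<omega>. cosh (c * W t \<omega>) \<partial>M) = exp (c\<^sup>2 * t / 2)"
    using i assms by (subst integral_cong_AE[OF _ _ c]) auto
  show "integrable M (\<lambda>\<omega>. sinh (c * W t \<omega>))"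
    using i assms by (subst integrable_cong_AE[OF _ _ s]) auto
qed

text \<open>The addition theorem splits \<open>cosh (c * W t)\<close> into cosh and sinh products of
  past and increment. Independence factors both; the sinh of the increment has mean 0, its cosh the
  stated exponential.\<close>

lemma integral_past_cosh:
  assumes s: "0 \<le> s" "s \<le> t" and A: "A \<in> sets (\<F> s)"
  shows "(\<integral>\<omega>. indicator A \<omega> * cosh (c * W t \<omega>) \<partial>M) =
    exp (c\<^sup>2 * (t - s) / 2) * (\<integral>\<omega>. indicator A \<omega> * cosh (c * W s \<omega>) \<partial>M)"
proof -
  have [measurable]: "(\<lambda>x. cosh (c * x)) \<in> borel_measurable borel" "(\<lambda>x. sinh (c * x)) \<in> borel_measurable borel"
    by (auto intro!: borel_measurable_continuous_onI continuous_intros)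
  have [measurable]: "W s \<in> borel_measurable (\<F> s)" "A \<in> sets (\<F> s)"
    using s A W_measurable_\<F> by auto
  have AM: "A \<in> sets M" using A subalgebra_\<F>[of s] by (auto simp: subalgebra_def)
  let ?I = "\<lambda>\<omega>. W t \<omega> - W s \<omega>"
  let ?C = "\<lambda>\<omega>. indicator A \<omega> * cosh (c * W s \<omega>)" and ?S = "\<lambda>\<omega>. indicator A \<omega> * sinh (c * W s \<omega>)"
  have indC: "indep_var borel ?C borel (\<lambda>\<omega>. cosh (c * ?I \<omega>))"
    by (rule indep_var_compose[OF indep_var_past_increment[OF s], of ?C "\<lambda>x. x" borel "\<lambda>x. cosh (c * x)" borel,
          unfolded comp_def]) measurable
  have indS: "indep_var borel ?S borel (\<lambda>\<omega>. sinh (c * ?I \<omega>))"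
    by (rule indep_var_compose[OF indep_var_past_increment[OF s], of ?S "\<lambda>x. x" borel "\<lambda>x. sinh (c * x)" borel,
          unfolded comp_def]) measurable
  have iC: "integrable M ?C" and iS: "integrable M ?S"
    using integrable_real_mult_indicator[OF AM integrable_cosh_W[OF s(1), of c]]
      integrable_real_mult_indicator[OF AM integrable_sinh_W[OF s(1), of c]]
    by (simp_all add: mult.commute)
  note i = cosh_increment[OF s, of c, simplified has_bochner_integral_iff]
  have "indicator A \<omega> * cosh (c * W t \<omega>) = ?C \<omega> * cosh (c * ?I \<omega>) + ?S \<omega> * sinh (c * ?I \<omega>)" for \<omega>
  proof -
    have "c * W s \<omega> + c * ?I \<omega> = c * W t \<omega>" by (simp add: right_diff_distrib)
    then have "cosh (c * W t \<omega>) = cosh (c * W s \<omega>) * cosh (c * ?I \<omega>) + sinh (c * W s \<omega>) * sinh (c * ?I \<omega>)"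
      using cosh_add[of "c * W s \<omega>" "c * ?I \<omega>"] by (simp only:)
    then show ?thesis by (simp only: distrib_left mult.assoc)
  qed
  then have "(\<integral>\<omega>. indicator A \<omega> * cosh (c * W t \<omega>) \<partial>M) =
      (\<integral>\<omega>. ?C \<omega> * cosh (c * ?I \<omega>) \<partial>M) + (\<integral>\<omega>. ?S \<omega> * sinh (c * ?I \<omega>) \<partial>M)"
    using indep_var_integrable[OF indC] indep_var_integrable[OF indS] i iC iS by simp
  also have "\<dots> = (\<integral>\<omega>. ?C \<omega> \<partial>M) * exp (c\<^sup>2 * (t - s) / 2) + (\<integral>\<omega>. ?S \<omega> \<partial>M) * 0"
    using indep_var_lebesgue_integral[OF indC] indep_var_lebesgue_integral[OF indS] i iC iS by simp
  finally show ?thesis by simp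
qed

lemma martingale_cosh:
  "martingale M \<F> (\<lambda>t \<omega>. cosh (c * W t \<omega>) / (\<integral>\<omega>'. cosh (c * W t \<omega>') \<partial>M))"
    (is "martingale M \<F> ?N")
  unfolding martingale_def
proof (intro conjI allI impI)
  have [measurable]: "(\<lambda>x. cosh (c * x)) \<in> borel_measurable borel"
    by (auto intro!: borel_measurable_continuous_onI continuous_intros)
  show meas: "?N t \<in> borel_measurable (\<F> t)" if "0 \<le> t" for t
    using that W_measurable_\<F>[of t t] by simp
  show int: "integrable M (?N t)" if "0 \<le> t" for t
    using that integrable_cosh_W by simp
  fix s t :: real assume s: "0 \<le> s" "s \<le> t"
  then have t: "0 \<le> t" by simp
  interpret finite_measure_subalgebra M "\<F> s"
    by unfold_locales (rule subalgebra_\<F>)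
  show "AE \<omega> in M. real_cond_exp M (\<F> s) (?N t) \<omega> = ?N s \<omega>"
  proof (rule real_cond_exp_charact)
    fix A assume A: "A \<in> sets (\<F> s)"
    have "exp (c\<^sup>2 * (t - s) / 2) = exp (c\<^sup>2 * t / 2) / exp (c\<^sup>2 * s / 2)"
      by (simp add: field_simps flip: exp_add)
    then have "(\<integral>\<omega>. indicator A \<omega> * cosh (c * W t \<omega>) \<partial>M) / exp (c\<^sup>2 * t / 2) =
        (\<integral>\<omega>. indicator A \<omega> * cosh (c * W s \<omega>) \<partial>M) / exp (c\<^sup>2 * s / 2)"
      using integral_past_cosh[OF s A, of c] by simp
    then show "(\<integral>\<omega>\<in>A. ?N t \<omega> \<partial>M) = (\<integral>\<omega>\<in>A. ?N s \<omega> \<partial>M)"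
      using s t by (simp add: set_lebesgue_integral_def integral_cosh_W)
  qed (use s t int meas in auto)
qed (use subalgebra_\<F> \<F>_mono in auto)

lemma right_continuous_cosh:
  "right_continuous_process M (\<lambda>t \<omega>. cosh (c * W t \<omega>) / (\<integral>\<omega>'. cosh (c * W t \<omega>') \<partial>M))"
  unfolding right_continuous_process_def
  using AE_continuous
proof eventually_elim
  case (elim \<omega>)
  show ?case
  proof (intro allI impI)
    fix t :: real assume t: "0 \<le> t"
    have "continuous_on {0..} (\<lambda>u. cosh (c * W u \<omega>) / exp (c\<^sup>2 * u / 2))"
      by (intro continuous_intros elim) auto
    then have "continuous (at_right t) (\<lambda>u. cosh (c * W u \<omega>) / exp (c\<^sup>2 * u / 2))"
      using t by (auto simp: continuous_on_eq_continuous_within intro: continuous_within_subset)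
    moreover have "\<forall>\<^sub>F u in at_right t. cosh (c * W u \<omega>) / exp (c\<^sup>2 * u / 2) =
        cosh (c * W u \<omega>) / (\<integral>\<omega>'. cosh (c * W u \<omega>') \<partial>M)"
      using eventually_at_right_less[of t] by eventually_elim (use t in \<open>simp add: integral_cosh_W\<close>)
    ultimately show "continuous (at_right t) (\<lambda>u. cosh (c * W u \<omega>) / (\<integral>\<omega>'. cosh (c * W u \<omega>') \<partial>M))"
      using t by (simp add: continuous_within integral_cosh_W tendsto_cong)
  qed
qed

end

section \<open>Second moments on product spaces\<close>

lemma measure_pair_Times:
  assumes "prob_space P" "prob_space Q" "A \<in> sets P" "B \<in> sets Q"
  shows "measure (P \<Otimes>\<^sub>M Q) (A \<times> B) = measure P A * measure Q B"
proof -
  interpret P: prob_space P by fact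
  interpret Q: prob_space Q by fact
  show ?thesis
    using assms by (simp add: measure_def Q.emeasure_pair_measure_Times enn2real_mult)
qed

lemma measure_pair_le_fst:
  assumes "prob_space P" "prob_space Q" "S \<in> sets (P \<Otimes>\<^sub>M Q)" "0 \<le> b"
    and le: "\<And>v. v \<in> space Q \<Longrightarrow> measure P {u \<in> space P. (u, v) \<in> S} \<le> b"
  shows "measure (P \<Otimes>\<^sub>M Q) S \<le> b"
proof -
  interpret P: prob_space P by fact
  interpret Q: prob_space Q by fact
  interpret PQ: pair_prob_space P Q ..
  have "emeasure (P \<Otimes>\<^sub>M Q) S = (\<integral>\<^sup>+v. emeasure P ((\<lambda>u. (u, v)) -` S) \<partial>Q)"
    by (rule PQ.emeasure_pair_measure_alt2) fact
  also have "\<dots> \<le> (\<integral>\<^sup>+v. ennreal b \<partial>Q)"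
  proof (rule nn_integral_mono)
    fix v assume v: "v \<in> space Q"
    have "(\<lambda>u. (u, v)) -` S = {u \<in> space P. (u, v) \<in> S}"
      using sets.sets_into_space[OF assms(3)] by (auto simp: space_pair_measure)
    then show "emeasure P ((\<lambda>u. (u, v)) -` S) \<le> ennreal b"
      using le[OF v] by (simp add: P.emeasure_eq_measure ennreal_leI)
  qed
  also have "\<dots> = ennreal b" by (simp add: Q.emeasure_space_1)
  finally show ?thesis
    using assms(4) by (simp add: PQ.emeasure_eq_measure)
qed

lemma measure_pair_le_snd:
  assumes "prob_space P" "prob_space Q" "S \<in> sets (P \<Otimes>\<^sub>M Q)" "0 \<le> b"
    and le: "\<And>u. u \<in> space P \<Longrightarrow> measure Q {v \<in> space Q. (u, v) \<in> S} \<le> b"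
  shows "measure (P \<Otimes>\<^sub>M Q) S \<le> b"
proof -
  interpret P: prob_space P by fact
  interpret Q: prob_space Q by fact
  interpret PQ: pair_prob_space P Q ..
  have "emeasure (P \<Otimes>\<^sub>M Q) S = (\<integral>\<^sup>+u. emeasure Q (Pair u -` S) \<partial>P)"
    by (rule Q.emeasure_pair_measure_alt) fact
  also have "\<dots> \<le> (\<integral>\<^sup>+u. ennreal b \<partial>P)"
  proof (rule nn_integral_mono)
    fix u assume u: "u \<in> space P"
    have "Pair u -` S = {v \<in> space Q. (u, v) \<in> S}"
      using sets.sets_into_space[OF assms(3)] by (auto simp: space_pair_measure)
    then show "emeasure Q (Pair u -` S) \<le> ennreal b"
      using le[OF u] by (simp add: Q.emeasure_eq_measure ennreal_leI)
  qed
  also have "\<dots> = ennreal b" by (simp add: P.emeasure_space_1)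
  finally show ?thesis
    using assms(4) by (simp add: PQ.emeasure_eq_measure)
qed

lemma measure_pair_ge_fst:
  assumes "prob_space P" "prob_space Q" "S \<in> sets (P \<Otimes>\<^sub>M Q)" "0 \<le> b" "V \<in> sets Q"
    and ge: "\<And>v. v \<in> V \<Longrightarrow> b \<le> measure P {u \<in> space P. (u, v) \<in> S}"
  shows "b * measure Q V \<le> measure (P \<Otimes>\<^sub>M Q) S"
proof -
  interpret P: prob_space P by fact
  interpret Q: prob_space Q by fact
  interpret PQ: pair_prob_space P Q ..
  have "ennreal (b * measure Q V) = (\<integral>\<^sup>+v. ennreal b * indicator V v \<partial>Q)"
    using assms by (simp add: nn_integral_cmult_indicator Q.emeasure_eq_measure ennreal_mult)
  also have "\<dots> \<le> (\<integral>\<^sup>+v. emeasure P ((\<lambda>u. (u, v)) -` S) \<partial>Q)"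
  proof (rule nn_integral_mono)
    fix v assume v: "v \<in> space Q"
    have "(\<lambda>u. (u, v)) -` S = {u \<in> space P. (u, v) \<in> S}"
      using sets.sets_into_space[OF assms(3)] by (auto simp: space_pair_measure)
    then show "ennreal b * indicator V v \<le> emeasure P ((\<lambda>u. (u, v)) -` S)"
      using ge[of v] by (simp add: P.emeasure_eq_measure split: split_indicator)
  qed
  also have "\<dots> = emeasure (P \<Otimes>\<^sub>M Q) S"
    by (rule PQ.emeasure_pair_measure_alt2[symmetric]) fact
  finally show ?thesis
    by (simp add: PQ.emeasure_eq_measure)
qed

text \<open>Let J count the events that occur. It vanishes off the union U, so expanding the
  nonnegative mean of \<open>(r * J - indicator U)^2\<close> bounds \<open>prob U\<close> from below
  by the first two moments of J.\<close>

lemma (in prob_space) second_moment: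
  assumes K: "finite K" and E: "\<And>k. k \<in> K \<Longrightarrow> E k \<in> events"
    and c: "c \<le> (\<Sum>k\<in>K. prob (E k))" "0 \<le> c"
    and D: "(\<Sum>k\<in>K. \<Sum>l\<in>K. prob (E k \<inter> E l)) \<le> D" "0 < D"
  shows "c\<^sup>2 / D \<le> prob (\<Union>k\<in>K. E k)"
proof -
  define U where "U = (\<Union>k\<in>K. E k)"
  define J where "J \<omega> = (\<Sum>k\<in>K. indicator (E k) \<omega> :: real)" for \<omega>
  \<comment> \<open>The minimiser of \<open>r^2 * D - 2 * r * c\<close>.\<close>
  define r where "r = c / D"
  note E [measurable]
  have [measurable]: "U \<in> events" unfolding U_def using K E by auto
  have J2: "J \<omega> * J \<omega> = (\<Sum>k\<in>K. \<Sum>l\<in>K. indicator (E k \<inter> E l) \<omega>)" for \<omega>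
    unfolding J_def sum_product by (simp add: indicator_inter_arith)
  have JU: "J \<omega> * indicator U \<omega> = J \<omega>" for \<omega>
    by (auto simp: J_def U_def split: split_indicator)
  have int: "integrable M (indicator A :: 'a \<Rightarrow> real)" if "A \<in> events" for A
    using that by (simp add: integrable_indicator_iff emeasure_eq_measure)
  have iE: "integrable M (indicator (E k \<inter> E l) :: 'a \<Rightarrow> real)" if "k \<in> K" "l \<in> K" for k l
    using that by (intro int) auto
  have iJ: "integrable M J" "integral\<^sup>L M J = (\<Sum>k\<in>K. prob (E k))"
    unfolding J_def using E int by auto
  have iJ2: "integrable M (\<lambda>\<omega>. J \<omega> * J \<omega>)" "(\<integral>\<omega>. J \<omega> * J \<omega> \<partial>M) = (\<Sum>k\<in>K. \<Sum>l\<in>K. prob (E k \<inter> E l))"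
    unfolding J2 using iE E by auto
  have "0 \<le> (\<integral>\<omega>. (r * J \<omega> - indicator U \<omega>)\<^sup>2 \<partial>M)" by (rule integral_nonneg_AE) auto
  also have "(\<lambda>\<omega>. (r * J \<omega> - indicator U \<omega>)\<^sup>2) = (\<lambda>\<omega>. r\<^sup>2 * (J \<omega> * J \<omega>) - 2 * r * J \<omega> + indicator U \<omega>)"
  proof
    fix \<omega> show "(r * J \<omega> - indicator U \<omega>)\<^sup>2 = r\<^sup>2 * (J \<omega> * J \<omega>) - 2 * r * J \<omega> + indicator U \<omega>"
      using JU[of \<omega>] by (auto simp: power2_eq_square algebra_simps split: split_indicator)
  qed
  also have "(\<integral>\<omega>. r\<^sup>2 * (J \<omega> * J \<omega>) - 2 * r * J \<omega> + indicator U \<omega> \<partial>M) =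
      r\<^sup>2 * (\<Sum>k\<in>K. \<Sum>l\<in>K. prob (E k \<inter> E l)) - 2 * r * (\<Sum>k\<in>K. prob (E k)) + prob U"
    using iJ iJ2 int[of U] by simp
  also have "\<dots> \<le> r\<^sup>2 * D - 2 * r * c + prob U"
    using c D by (intro add_mono diff_mono mult_left_mono) (auto simp: r_def)
  also have "r\<^sup>2 * D - 2 * r * c = - (c\<^sup>2 / D)"
    using D by (simp add: r_def field_simps power2_eq_square)
  finally show ?thesis by (simp add: U_def)
qed

text \<open>Up to a constant, the price of a second visit to a ball of radius 1/sqrt n at a lag of
  \<open>|i - j|\<close> time steps of length 1/n; at lag 0 the second visit may be free.\<close>

definition lag_weight :: "nat \<Rightarrow> nat \<Rightarrow> real" where
  "lag_weight i j = (if i = j then 1 else 1 / sqrt \<bar>real i - real j\<bar>)"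

lemma lag_weight_nonneg: "0 \<le> lag_weight i j"
  by (simp add: lag_weight_def)

lemma lag_weight_commute: "lag_weight i j = lag_weight j i"
  by (auto simp: lag_weight_def abs_minus_commute)

text \<open>Telescoping: for the fourth roots a and b of n and n + 1,
  \<open>1 = b^4 - a^4 <= 4 * (b - a) * b^3\<close>.\<close>

lemma sum_powr_three_quarters_le:
  "(\<Sum>k<n. real (Suc k) powr (- 3 / 4)) \<le> 4 * real n powr (1 / 4)"
proof (induction n)
  case (Suc n)
  define a where "a = real n powr (1 / 4)"
  define b where "b = real (Suc n) powr (1 / 4)"
  have ab: "0 \<le> a" "a \<le> b" "0 < b" by (auto simp: a_def b_def intro: powr_mono2)
  have a4: "a ^ 4 = real n" by (cases "n = 0") (auto simp: a_def powr_power)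
  have b4: "b ^ 4 = real n + 1" by (auto simp: b_def powr_power)
  have b3: "real (Suc n) powr - (3 / 4) = 1 / b ^ 3"
    by (simp add: b_def powr_power powr_minus_divide)
  have "1 = b ^ 4 - a ^ 4" by (simp add: a4 b4)
  also have "\<dots> = (b - a) * ((b + a) * (b\<^sup>2 + a\<^sup>2))"
    by (simp add: algebra_simps power2_eq_square power4_eq_xxxx)
  also have "\<dots> \<le> (b - a) * ((b + b) * (b\<^sup>2 + b\<^sup>2))"
    using ab by (intro mult_left_mono mult_mono add_mono power_mono) auto
  also have "\<dots> = 4 * (b - a) * b ^ 3" by (simp add: power2_eq_square power3_eq_cube algebra_simps)
  finally have "1 / b ^ 3 \<le> 4 * (b - a)" using ab by (simp add: field_simps)
  with Suc show ?case by (simp add: a_def[symmetric] b_def[symmetric] b3 del: of_nat_Suc)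
qed simp

text \<open>Each time index enters one outer hitting event, with the full weight, and the middle
  meeting event, with its square root; together the exponent is 1/2 + 1/4.\<close>

lemma lag_weight_powr:
  "lag_weight i j * sqrt (lag_weight i j) = (if i = j then 1 else \<bar>real i - real j\<bar> powr (- 3 / 4))"
proof (cases "i = j")
  case False
  define d where "d = \<bar>real i - real j\<bar>"
  have d: "0 < d" using False by (simp add: d_def)
  have "lag_weight i j = d powr (- 1 / 2)"
    using False d by (simp add: lag_weight_def d_def[symmetric] powr_minus_divide powr_half_sqrt)
  moreover have "sqrt (d powr (- 1 / 2)) = d powr (- 1 / 4)"
    using d by (simp add: powr_half_sqrt[symmetric] powr_powr)
  ultimately show ?thesis
    using False d by (simp add: d_def[symmetric] powr_add[symmetric])
qed (simp add: lag_weight_def)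

text \<open>The indices below and above i give at most 4 n^(1/4) each; the diagonal term 1 is
  absorbed because n >= 1, whence 9.\<close>

lemma sum_lag_weight_le:
  assumes "i < n"
  shows "(\<Sum>j<n. lag_weight i j * sqrt (lag_weight i j)) \<le> 9 * real n powr (1 / 4)"
proof -
  let ?w = "\<lambda>j. lag_weight i j * sqrt (lag_weight i j)"
  let ?h = "\<lambda>k. real (Suc k) powr (- 3 / 4)"
  have "{..<n} = {..<i} \<union> {i} \<union> {Suc i..<n}" using assms by auto
  then have "(\<Sum>j<n. ?w j) = (\<Sum>j\<in>{..<i} \<union> {i} \<union> {Suc i..<n}. ?w j)" by simp
  also have "\<dots> = (\<Sum>j<i. ?w j) + ?w i + (\<Sum>j\<in>{Suc i..<n}. ?w j)"
    by (subst sum.union_disjoint) auto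
  also have "(\<Sum>j<i. ?w j) = (\<Sum>j<i. ?h (i - Suc j))"
    by (intro sum.cong) (auto simp: lag_weight_powr Suc_diff_Suc of_nat_diff simp del: of_nat_Suc)
  also have "\<dots> = (\<Sum>k<i. ?h k)" by (rule sum.nat_diff_reindex)
  also have "\<dots> \<le> (\<Sum>k<n. ?h k)" using assms by (intro sum_mono2) auto
  also have "(\<Sum>j\<in>{Suc i..<n}. ?w j) = (\<Sum>j\<in>{Suc i..<n}. ?h (j - Suc i))"
    by (intro sum.cong) (auto simp: lag_weight_powr Suc_diff_Suc of_nat_diff simp del: of_nat_Suc)
  also have "\<dots> = (\<Sum>k<n - Suc i. ?h k)"
    by (rule sum.reindex_bij_witness[of _ "\<lambda>k. k + Suc i" "\<lambda>j. j - Suc i"]) auto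
  also have "\<dots> \<le> (\<Sum>k<n. ?h k)" by (intro sum_mono2) auto
  also have "?w i = 1" by (simp add: lag_weight_def)
  finally have "(\<Sum>j<n. ?w j) \<le> 1 + 2 * (\<Sum>k<n. ?h k)" by simp
  also have "\<dots> \<le> 1 + 2 * (4 * real n powr (1 / 4))"
    by (intro add_mono mult_left_mono sum_powr_three_quarters_le) auto
  finally show ?thesis
    using ge_one_powr_ge_zero[of "real n" "1 / 4"] assms by simp
qed

section \<open>Chains of coincidences of four Brownian motions\<close>

text \<open>For t in [1,2] the density of \<open>W t\<close> within distance 1 of a is at least
  \<open>exp (- (|a| + 1)^2 / 2) / 4\<close>, as \<open>sqrt (2 * pi * t) <= 4\<close>; an interval
  of length 2e leaves the factor 1/2 per unit of e.\<close>

definition small_ball_const :: "real \<Rightarrow> real" where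
  "small_ball_const a = exp (- (\<bar>a\<bar> + 1)\<^sup>2 / 2) / 2"

context brownian
begin

section \<open>Small-ball probabilities of Brownian motion\<close>

lemma prob_ball_le:
  assumes X: "distributed M lborel X (\<lambda>x. ennreal (normal_density 0 \<sigma> x))" and "0 < \<sigma>" "0 \<le> e"
  shows "prob {\<omega> \<in> space M. \<bar>X \<omega> - a\<bar> < e} \<le> 2 * e / \<sigma>"
proof -
  have dens: "normal_density 0 \<sigma> x \<le> 1 / \<sigma>" for x
  proof -
    have "1 \<le> sqrt (2 * pi)" using pi_gt3 by simp
    then have "\<sigma> \<le> sqrt (2 * pi * \<sigma>\<^sup>2)" using \<open>0 < \<sigma>\<close> by (simp add: real_sqrt_mult)
    moreover have "exp (- x\<^sup>2 / (2 * \<sigma>\<^sup>2)) \<le> 1" by simp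
    ultimately have "1 / sqrt (2 * pi * \<sigma>\<^sup>2) * exp (- x\<^sup>2 / (2 * \<sigma>\<^sup>2)) \<le> 1 / \<sigma> * 1"
      using \<open>0 < \<sigma>\<close> by (intro mult_mono divide_left_mono) auto
    then show ?thesis by (simp add: normal_density_def)
  qed
  have "emeasure M {\<omega> \<in> space M. \<bar>X \<omega> - a\<bar> < e} = emeasure M (X -` {a - e<..<a + e} \<inter> space M)"
    by (rule arg_cong[where f="emeasure M"]) auto
  also have "\<dots> = (\<integral>\<^sup>+x. ennreal (normal_density 0 \<sigma> x) * indicator {a - e<..<a + e} x \<partial>lborel)"
    by (rule distributed_emeasure[OF X]) auto
  also have "\<dots> \<le> (\<integral>\<^sup>+x. ennreal (1 / \<sigma>) * indicator {a - e<..<a + e} x \<partial>lborel)"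
    using dens by (intro nn_integral_mono mult_right_mono ennreal_leI) auto
  also have "\<dots> = ennreal (2 * e / \<sigma>)"
    using assms(2,3) by (simp add: nn_integral_cmult_indicator flip: ennreal_mult)
  finally show ?thesis using assms(2,3) by (simp add: emeasure_eq_measure)
qed

lemma prob_ball_ge:
  assumes t: "1 \<le> t" "t \<le> 2" and e: "0 < e" "e \<le> 1"
  shows "e * small_ball_const a \<le> prob {\<omega> \<in> space M. \<bar>W t \<omega> - a\<bar> < e}"
proof -
  define d where "d = exp (- (\<bar>a\<bar> + 1)\<^sup>2 / 2) / 4"
  have dens: "d \<le> normal_density 0 (sqrt t) x" if "x \<in> {a - e<..<a + e}" for x
  proof -
    have "2 * pi * t \<le> 2 * 4 * 2" using t pi_less_4 by (intro mult_mono) auto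
    then have "sqrt (2 * pi * t) \<le> sqrt (4\<^sup>2)" by (intro real_sqrt_le_mono) simp
    then have 1: "1 / 4 \<le> 1 / sqrt (2 * pi * t)" using t by (simp add: field_simps)
    have "\<bar>x\<bar> \<le> \<bar>a\<bar> + 1" using that e by auto
    then have "x\<^sup>2 \<le> (\<bar>a\<bar> + 1)\<^sup>2" by (simp add: abs_le_square_iff[symmetric])
    then have "x\<^sup>2 * 2 \<le> (\<bar>a\<bar> + 1)\<^sup>2 * (2 * t)" using t by (intro mult_mono) auto
    then have "- (\<bar>a\<bar> + 1)\<^sup>2 / 2 \<le> - x\<^sup>2 / (2 * t)" using t by (simp add: field_simps)
    then have "1 / 4 * exp (- (\<bar>a\<bar> + 1)\<^sup>2 / 2) \<le> 1 / sqrt (2 * pi * t) * exp (- x\<^sup>2 / (2 * t))"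
      using 1 t by (intro mult_mono) auto
    then show ?thesis using t by (simp add: d_def normal_density_def)
  qed
  have "ennreal (e * small_ball_const a) = (\<integral>\<^sup>+x. ennreal d * indicator {a - e<..<a + e} x \<partial>lborel)"
    using e by (simp add: nn_integral_cmult_indicator d_def small_ball_const_def flip: ennreal_mult)
  also have "\<dots> \<le> (\<integral>\<^sup>+x. ennreal (normal_density 0 (sqrt t) x) * indicator {a - e<..<a + e} x \<partial>lborel)"
    using dens by (intro nn_integral_mono) (auto split: split_indicator intro!: ennreal_leI)
  also have "\<dots> = emeasure M (W t -` {a - e<..<a + e} \<inter> space M)"
    using t by (intro distributed_emeasure[OF distributed_W, symmetric]) auto
  also have "\<dots> = emeasure M {\<omega> \<in> space M. \<bar>W t \<omega> - a\<bar> < e}"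
    by (rule arg_cong[where f="emeasure M"]) auto
  finally show ?thesis by (simp add: emeasure_eq_measure)
qed

text \<open>Lying in both balls forces the increment into the ball of radius 2e about b - a, which
  is independent of the value at s. The densities are at most 1/sqrt s <= 1 and 1/sqrt (t -
  s).\<close>

lemma prob_two_balls_le:
  assumes st: "1 \<le> s" "s < t" and e: "0 \<le> e"
  shows "prob {\<omega> \<in> space M. \<bar>W s \<omega> - a\<bar> < e \<and> \<bar>W t \<omega> - b\<bar> < e} \<le> 8 * e * (e / sqrt (t - s))"
proof -
  have [measurable]: "W s \<in> borel_measurable M" "W t \<in> borel_measurable M" using st by auto
  let ?A = "{x. \<bar>x - a\<bar> < e}" and ?B = "{x. \<bar>x - (b - a)\<bar> < 2 * e}"
  have "prob {\<omega> \<in> space M. \<bar>W s \<omega> - a\<bar> < e \<and> \<bar>W t \<omega> - b\<bar> < e} \<le>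
      prob {\<omega> \<in> space M. W s \<omega> \<in> ?A \<and> W t \<omega> - W s \<omega> \<in> ?B}"
    by (intro finite_measure_mono) auto
  also have "\<dots> = prob {\<omega> \<in> space M. W s \<omega> \<in> ?A} * prob {\<omega> \<in> space M. W t \<omega> - W s \<omega> \<in> ?B}"
    using st by (intro prob_indep_random_variable[where N=borel] indep_var_past_increment W_measurable_\<F>) auto
  also have "\<dots> \<le> (2 * e / sqrt s) * (2 * (2 * e) / sqrt (t - s))"
    using st e prob_ball_le[OF distributed_W, of s e a] prob_ball_le[OF distributed_increment, of s t "2 * e" "b - a"]
    by (intro mult_mono) auto
  also have "\<dots> \<le> (2 * e / 1) * (2 * (2 * e) / sqrt (t - s))"
    using st e by (intro mult_right_mono divide_left_mono) auto
  finally show ?thesis by simp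
qed

text \<open>Over one step of length 1/n a Brownian path moves by about 1/sqrt n, which is the ball
  radius used with this grid. Starting at 1 keeps the variances away from 0.\<close>

definition grid :: "nat \<Rightarrow> nat \<Rightarrow> real" where
  "grid n i = 1 + real i / real n"

lemma prob_two_balls_grid_le:
  assumes n: "0 < n"
  shows "prob {\<omega> \<in> space M. \<bar>W (grid n i) \<omega> - a\<bar> < 1 / sqrt n \<and> \<bar>W (grid n j) \<omega> - b\<bar> < 1 / sqrt n}
    \<le> 8 / sqrt n * lag_weight i j"
proof -
  have less: "prob {\<omega> \<in> space M. \<bar>W (grid n i) \<omega> - a\<bar> < 1 / sqrt n \<and> \<bar>W (grid n j) \<omega> - b\<bar> < 1 / sqrt n}
    \<le> 8 / sqrt n * lag_weight i j" if "i < j" for i j a b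
  proof -
    have "(1 / sqrt n) / sqrt (grid n j - grid n i) = lag_weight i j"
      using that n by (simp add: grid_def lag_weight_def real_sqrt_divide[symmetric] field_simps
          flip: diff_divide_distrib real_sqrt_mult)
    then show ?thesis
      using prob_two_balls_le[of "grid n i" "grid n j" "1 / sqrt n" a b] that n
      by (simp add: grid_def divide_strict_right_mono)
  qed
  consider "i < j" | "j < i" | "i = j" by linarith
  then show ?thesis
  proof cases
    case 1
    then show ?thesis by (rule less)
  next
    case 2
    then show ?thesis using less[OF 2, of b a] by (simp add: conj_commute lag_weight_commute)
  next
    case 3
    have [measurable]: "W (grid n i) \<in> borel_measurable M" by (rule W_measurable) (simp add: grid_def)
    have "prob {\<omega> \<in> space M. \<bar>W (grid n i) \<omega> - a\<bar> < 1 / sqrt n \<and> \<bar>W (grid n j) \<omega> - b\<bar> < 1 / sqrt n}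
        \<le> prob {\<omega> \<in> space M. \<bar>W (grid n i) \<omega> - a\<bar> < 1 / sqrt n}"
      by (intro finite_measure_mono) auto
    also have "\<dots> \<le> 2 * (1 / sqrt n) / sqrt (grid n i)"
      by (intro prob_ball_le distributed_W) (auto simp: grid_def add_pos_nonneg)
    also have "\<dots> \<le> 2 * (1 / sqrt n) / 1"
      by (intro divide_left_mono) (auto simp: grid_def add_pos_nonneg)
    also have "\<dots> \<le> 8 / sqrt n * lag_weight i j"
      using 3 by (simp add: lag_weight_def divide_right_mono)
    finally show ?thesis .
  qed
qed

text \<open>The geometric mean of the bounds obtained by freezing either path: with the two outer factors
  it gives each lag the exponent 3/4, so the second moment stays comparable to the squared mean.\<close>

lemma prob_difference_grid_le:
  assumes n: "0 < n"
  shows "measure (M \<Otimes>\<^sub>M M) {p \<in> space (M \<Otimes>\<^sub>M M).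
      \<bar>W (grid n i) (fst p) - W (grid n j) (snd p)\<bar> < 1 / sqrt n \<and>
      \<bar>W (grid n i') (fst p) - W (grid n j') (snd p)\<bar> < 1 / sqrt n}
    \<le> 8 / sqrt n * (sqrt (lag_weight i i') * sqrt (lag_weight j j'))" (is "measure _ ?S \<le> _")
proof -
  have [measurable]: "W (grid n i) \<in> borel_measurable M" for i by (rule W_measurable) (simp add: grid_def)
  have S: "?S \<in> sets (M \<Otimes>\<^sub>M M)" by measurable
  have 1: "measure (M \<Otimes>\<^sub>M M) ?S \<le> 8 / sqrt n * lag_weight i i'"
  proof (rule measure_pair_le_fst[OF _ _ S])
    fix v assume "v \<in> space M"
    then have "{u \<in> space M. (u, v) \<in> ?S} = {u \<in> space M. \<bar>W (grid n i) u - W (grid n j) v\<bar> < 1 / sqrt n \<and>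
        \<bar>W (grid n i') u - W (grid n j') v\<bar> < 1 / sqrt n}"
      by (auto simp: space_pair_measure)
    then show "prob {u \<in> space M. (u, v) \<in> ?S} \<le> 8 / sqrt n * lag_weight i i'"
      using prob_two_balls_grid_le[OF n] by simp
  qed (auto simp: prob_space_axioms lag_weight_nonneg)
  have 2: "measure (M \<Otimes>\<^sub>M M) ?S \<le> 8 / sqrt n * lag_weight j j'"
  proof (rule measure_pair_le_snd[OF _ _ S])
    fix u assume "u \<in> space M"
    then have "{v \<in> space M. (u, v) \<in> ?S} = {v \<in> space M. \<bar>W (grid n j) v - W (grid n i) u\<bar> < 1 / sqrt n \<and>
        \<bar>W (grid n j') v - W (grid n i') u\<bar> < 1 / sqrt n}"
      by (auto simp: space_pair_measure abs_minus_commute)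
    then show "prob {v \<in> space M. (u, v) \<in> ?S} \<le> 8 / sqrt n * lag_weight j j'"
      using prob_two_balls_grid_le[OF n] by simp
  qed (auto simp: prob_space_axioms lag_weight_nonneg)
  define a b m where "a = 8 / sqrt n * lag_weight i i'" and "b = 8 / sqrt n * lag_weight j j'"
    and "m = measure (M \<Otimes>\<^sub>M M) ?S"
  have "m * m \<le> a * b"
    using 1 2 lag_weight_nonneg unfolding a_def b_def m_def by (intro mult_mono) auto
  then have "sqrt (m * m) \<le> sqrt (a * b)" by (rule real_sqrt_le_mono)
  moreover have "sqrt (m * m) = m" by (simp add: m_def)
  moreover have "sqrt (a * b) = 8 / sqrt n * (sqrt (lag_weight i i') * sqrt (lag_weight j j'))"
  proof -
    have "a * b = (8 / sqrt n)\<^sup>2 * (lag_weight i i' * lag_weight j j')"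
      by (simp add: a_def b_def power2_eq_square)
    then show ?thesis by (simp only: real_sqrt_mult real_sqrt_abs) simp
  qed
  ultimately show ?thesis by (simp add: m_def)
qed

text \<open>Freeze the second path while its value is within 1 of the origin, an event of
  probability at least \<open>small_ball_const 0\<close>. The first path then has to hit a ball
  centred in [-1,1], where the worst constant is \<open>small_ball_const 1\<close>.\<close>

lemma prob_difference_grid_ge:
  assumes n: "0 < n" and ij: "i < n" "j < n"
  shows "small_ball_const 1 * small_ball_const 0 / sqrt n \<le> measure (M \<Otimes>\<^sub>M M) {p \<in> space (M \<Otimes>\<^sub>M M).
      \<bar>W (grid n i) (fst p) - W (grid n j) (snd p)\<bar> < 1 / sqrt n}" (is "_ \<le> measure _ ?S")
proof -
  have [measurable]: "W (grid n i) \<in> borel_measurable M" for i by (rule W_measurable) (simp add: grid_def)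
  have S: "?S \<in> sets (M \<Otimes>\<^sub>M M)" by measurable
  have grid: "1 \<le> grid n i" "grid n i \<le> 2" if "i < n" for i using that by (auto simp: grid_def)
  have e: "0 < 1 / sqrt n" "1 / sqrt n \<le> 1" using n by auto
  let ?V = "{v \<in> space M. \<bar>W (grid n j) v - 0\<bar> < 1}"
  have V: "?V \<in> events" by measurable
  have "(1 / sqrt n * small_ball_const 1) * prob ?V \<le> measure (M \<Otimes>\<^sub>M M) ?S"
  proof (rule measure_pair_ge_fst[OF _ _ S _ V])
    fix v assume v: "v \<in> ?V"
    have "(\<bar>W (grid n j) v\<bar> + 1)\<^sup>2 \<le> (\<bar>1\<bar> + 1)\<^sup>2" using v by (intro power_mono) auto
    then have "small_ball_const 1 \<le> small_ball_const (W (grid n j) v)"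
      unfolding small_ball_const_def by (intro divide_right_mono) auto
    then have "1 / sqrt n * small_ball_const 1 \<le> 1 / sqrt n * small_ball_const (W (grid n j) v)"
      by (intro mult_left_mono) auto
    also have "\<dots> \<le> prob {u \<in> space M. \<bar>W (grid n i) u - W (grid n j) v\<bar> < 1 / sqrt n}"
      using grid ij e by (intro prob_ball_ge) auto
    also have "{u \<in> space M. \<bar>W (grid n i) u - W (grid n j) v\<bar> < 1 / sqrt n} = {u \<in> space M. (u, v) \<in> ?S}"
      using v by (auto simp: space_pair_measure)
    finally show "1 / sqrt n * small_ball_const 1 \<le> prob {u \<in> space M. (u, v) \<in> ?S}" .
  qed (auto simp: prob_space_axioms small_ball_const_def)
  moreover have "1 * small_ball_const 0 \<le> prob ?V" using grid ij by (intro prob_ball_ge) auto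
  then have "(1 / sqrt n * small_ball_const 1) * small_ball_const 0 \<le> (1 / sqrt n * small_ball_const 1) * prob ?V"
    by (intro mult_left_mono) (auto simp: small_ball_const_def)
  ultimately show ?thesis by simp
qed

text \<open>The nesting keeps the second and third paths together, so that each grid event for the
  chain is a product set with the meeting event as one factor.\<close>

abbreviation "M4 \<equiv> M \<Otimes>\<^sub>M ((M \<Otimes>\<^sub>M M) \<Otimes>\<^sub>M M)"

lemma prob_space_M4: "prob_space M4"
  by (intro prob_space_pair prob_space_axioms)

section \<open>Approximate chains on the time grid\<close>

definition grid_hit :: "real \<Rightarrow> nat \<Rightarrow> nat \<Rightarrow> 'a set" where
  "grid_hit x n i = {\<omega> \<in> space M. \<bar>W (grid n i) \<omega> - x\<bar> < 1 / sqrt n}"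

definition grid_meet :: "nat \<Rightarrow> nat \<times> nat \<Rightarrow> ('a \<times> 'a) set" where
  "grid_meet n k = {p \<in> space (M \<Otimes>\<^sub>M M). \<bar>W (grid n (fst k)) (fst p) - W (grid n (snd k)) (snd p)\<bar> < 1 / sqrt n}"

definition grid_chain :: "real \<Rightarrow> nat \<Rightarrow> nat \<times> nat \<Rightarrow> ('a \<times> ('a \<times> 'a) \<times> 'a) set" where
  "grid_chain x n k = grid_hit x n (fst k) \<times> (grid_meet n k \<times> grid_hit 0 n (snd k))"

lemma grid_sets [measurable]:
  "grid_hit x n i \<in> sets M" "grid_meet n k \<in> sets (M \<Otimes>\<^sub>M M)" "grid_chain x n k \<in> sets M4"
proof -
  have [measurable]: "W (grid n i) \<in> borel_measurable M" for i by (rule W_measurable) (simp add: grid_def)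
  show [measurable]: "grid_hit x n i \<in> sets M" "grid_meet n k \<in> sets (M \<Otimes>\<^sub>M M)" for x i
    unfolding grid_hit_def grid_meet_def by measurable
  show "grid_chain x n k \<in> sets M4" unfolding grid_chain_def by measurable
qed

lemma prob_chain_Times:
  assumes "A \<in> sets M" "B \<in> sets (M \<Otimes>\<^sub>M M)" "D \<in> sets M"
  shows "measure M4 (A \<times> (B \<times> D)) = prob A * (measure (M \<Otimes>\<^sub>M M) B * prob D)"
  using assms by (simp add: measure_pair_Times prob_space_pair prob_space_axioms)

lemma prob_grid_chain_ge:
  assumes n: "0 < n" and k: "k \<in> {..<n} \<times> {..<n}"
  shows "small_ball_const x * small_ball_const 1 * (small_ball_const 0)\<^sup>2 / (sqrt n * sqrt n * sqrt n)
    \<le> measure M4 (grid_chain x n k)"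
proof -
  have e: "0 < 1 / sqrt n" "1 / sqrt n \<le> 1" using n by auto
  have hit: "1 / sqrt n * small_ball_const x \<le> prob (grid_hit x n i)" if "i < n" for x i
    unfolding grid_hit_def using e that by (intro prob_ball_ge) (auto simp: grid_def)
  have "(1 / sqrt n * small_ball_const x) * ((small_ball_const 1 * small_ball_const 0 / sqrt n) * (1 / sqrt n * small_ball_const 0))
      \<le> prob (grid_hit x n (fst k)) * (measure (M \<Otimes>\<^sub>M M) (grid_meet n k) * prob (grid_hit 0 n (snd k)))"
    using k prob_difference_grid_ge[OF n, of "fst k" "snd k"]
    by (intro mult_mono hit) (auto simp: grid_meet_def small_ball_const_def)
  then show ?thesis
    by (simp add: grid_chain_def prob_chain_Times power2_eq_square mult_ac)
qed

text \<open>Each of the three independent factors contributes 8/sqrt n, whence 512; the weights are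
  then regrouped by time index.\<close>

lemma prob_grid_chain_Int_le:
  assumes n: "0 < n"
  defines "w \<equiv> \<lambda>i j. lag_weight i j * sqrt (lag_weight i j)"
  shows "measure M4 (grid_chain x n k \<inter> grid_chain x n l)
    \<le> 512 / (sqrt n * sqrt n * sqrt n) * (w (fst k) (fst l) * w (snd k) (snd l))"
proof -
  have hit: "prob (grid_hit x n i \<inter> grid_hit x n j) \<le> 8 / sqrt n * lag_weight i j" for x i j
  proof -
    have "grid_hit x n i \<inter> grid_hit x n j = {\<omega> \<in> space M. \<bar>W (grid n i) \<omega> - x\<bar> < 1 / sqrt n \<and> \<bar>W (grid n j) \<omega> - x\<bar> < 1 / sqrt n}"
      by (auto simp: grid_hit_def)
    then show ?thesis using prob_two_balls_grid_le[OF n] by simp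
  qed
  have meet: "measure (M \<Otimes>\<^sub>M M) (grid_meet n k \<inter> grid_meet n l) \<le>
      8 / sqrt n * (sqrt (lag_weight (fst k) (fst l)) * sqrt (lag_weight (snd k) (snd l)))"
  proof -
    have "grid_meet n k \<inter> grid_meet n l = {p \<in> space (M \<Otimes>\<^sub>M M).
      \<bar>W (grid n (fst k)) (fst p) - W (grid n (snd k)) (snd p)\<bar> < 1 / sqrt n \<and>
      \<bar>W (grid n (fst l)) (fst p) - W (grid n (snd l)) (snd p)\<bar> < 1 / sqrt n}"
      by (auto simp: grid_meet_def)
    then show ?thesis using prob_difference_grid_le[OF n] by simp
  qed
  have "measure M4 (grid_chain x n k \<inter> grid_chain x n l) =
      prob (grid_hit x n (fst k) \<inter> grid_hit x n (fst l)) *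
      (measure (M \<Otimes>\<^sub>M M) (grid_meet n k \<inter> grid_meet n l) * prob (grid_hit 0 n (snd k) \<inter> grid_hit 0 n (snd l)))"
    unfolding grid_chain_def Times_Int_Times by (rule prob_chain_Times) auto
  also have "\<dots> \<le> (8 / sqrt n * lag_weight (fst k) (fst l)) *
      ((8 / sqrt n * (sqrt (lag_weight (fst k) (fst l)) * sqrt (lag_weight (snd k) (snd l)))) *
       (8 / sqrt n * lag_weight (snd k) (snd l)))"
    by (intro mult_mono hit meet) (auto simp: lag_weight_nonneg)
  finally show ?thesis by (simp add: w_def mult_ac)
qed

text \<open>The bound must not depend on n. The n^2 pairs give a mean count of at least c sqrt n,
  while the second moment is at most n^2 * 512 n^(-3/2) * (9 n^(1/4))^2 = 41472 n, so n cancels in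
  the second moment inequality.\<close>

lemma prob_ex_grid_chain_ge:
  assumes n: "0 < n"
  shows "(small_ball_const x * small_ball_const 1 * (small_ball_const 0)\<^sup>2)\<^sup>2 / 41472
    \<le> measure M4 (\<Union>k\<in>{..<n} \<times> {..<n}. grid_chain x n k)"
proof -
  interpret M4: prob_space M4 by (rule prob_space_M4)
  define c where "c = small_ball_const x * small_ball_const 1 * (small_ball_const 0)\<^sup>2"
  define w where "w = (\<lambda>i j. lag_weight i j * sqrt (lag_weight i j))"
  define K where "K = {..<n} \<times> {..<n}"
  have c: "0 \<le> c" by (simp add: c_def small_ball_const_def)
  have sn: "sqrt (real n) * sqrt (real n) = real n" by simp
  have r3: "sqrt (real n) * sqrt (real n) * sqrt (real n) = real n * sqrt (real n)" by simp
  have n14: "real n powr (1 / 4) * real n powr (1 / 4) = sqrt (real n)"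
    using n by (simp add: powr_half_sqrt flip: powr_add)
  have "(\<Sum>k\<in>K. c / (sqrt n * sqrt n * sqrt n)) \<le> (\<Sum>k\<in>K. measure M4 (grid_chain x n k))"
    using prob_grid_chain_ge[OF n] unfolding c_def K_def by (intro sum_mono) auto
  moreover have "(\<Sum>k\<in>K. c / (sqrt n * sqrt n * sqrt n)) = c * sqrt n"
    using n unfolding r3 by (simp add: K_def field_simps)
  ultimately have 1: "c * sqrt n \<le> (\<Sum>k\<in>K. measure M4 (grid_chain x n k))" by simp
  have "(\<Sum>k\<in>K. \<Sum>l\<in>K. measure M4 (grid_chain x n k \<inter> grid_chain x n l)) \<le>
      (\<Sum>k\<in>K. \<Sum>l\<in>K. 512 / (sqrt n * sqrt n * sqrt n) * (w (fst k) (fst l) * w (snd k) (snd l)))"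
    unfolding w_def by (intro sum_mono prob_grid_chain_Int_le n)
  also have "\<dots> \<le> (\<Sum>k\<in>K. 512 / (sqrt n * sqrt n * sqrt n) * ((9 * n powr (1 / 4)) * (9 * n powr (1 / 4))))"
  proof (rule sum_mono)
    fix k assume k: "k \<in> K"
    have w0: "0 \<le> w i j" for i j by (simp add: w_def lag_weight_nonneg)
    have "(\<Sum>l\<in>K. w (fst k) (fst l) * w (snd k) (snd l)) = (\<Sum>i<n. w (fst k) i) * (\<Sum>j<n. w (snd k) j)"
      unfolding sum_product K_def sum.cartesian_product by (simp add: case_prod_beta)
    also have "\<dots> \<le> (9 * n powr (1 / 4)) * (9 * n powr (1 / 4))"
      using k w0 unfolding w_def by (intro mult_mono sum_lag_weight_le sum_nonneg) (auto simp: K_def)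
    finally show "(\<Sum>l\<in>K. 512 / (sqrt n * sqrt n * sqrt n) * (w (fst k) (fst l) * w (snd k) (snd l))) \<le>
        512 / (sqrt n * sqrt n * sqrt n) * ((9 * n powr (1 / 4)) * (9 * n powr (1 / 4)))"
      unfolding sum_distrib_left[symmetric] by (intro mult_left_mono) auto
  qed
  also have "\<dots> = 41472 * real n"
  proof -
    have "(9 * real n powr (1 / 4)) * (9 * real n powr (1 / 4)) = 81 * sqrt n"
      using n14 by (simp add: mult_ac)
    then show ?thesis using n unfolding r3 by (simp add: K_def)
  qed
  finally have "(\<Sum>k\<in>K. \<Sum>l\<in>K. measure M4 (grid_chain x n k \<inter> grid_chain x n l)) \<le> 41472 * real n" .
  from M4.second_moment[OF _ _ 1 _ this] c n
  have "(c * sqrt n)\<^sup>2 / (41472 * real n) \<le> measure M4 (\<Union>k\<in>K. grid_chain x n k)"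
    by (simp add: K_def)
  moreover have "(c * sqrt n)\<^sup>2 / (41472 * real n) = c\<^sup>2 / 41472"
    using n by (simp add: power_mult_distrib)
  ultimately show ?thesis by (simp add: c_def K_def)
qed

definition chain :: "real \<Rightarrow> 'a \<times> ('a \<times> 'a) \<times> 'a \<Rightarrow> bool" where
  "chain x = (\<lambda>(\<omega>1, (\<omega>2, \<omega>3), \<omega>4).
    \<exists>t\<in>{1..2}. \<exists>r\<in>{1..2}. W t \<omega>1 = x \<and> W t \<omega>2 = W r \<omega>3 \<and> W r \<omega>4 = 0)"

text \<open>U consists of the quadruples with approximate chains on arbitrarily fine grids;
  continuity from above preserves the uniform lower bound. For continuous paths the total defect
  \<open>\<Psi>\<close> of the three equations attains its minimum on the compact square of times,
  and approximate chains force this minimum to be 0. A measurable U stands in for the event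
  \<open>chain\<close> itself.\<close>

lemma chain_positive:
  obtains U where "U \<in> sets M4" "0 < measure M4 U"
    "\<And>\<omega>1 \<omega>2 \<omega>3 \<omega>4. (\<omega>1, (\<omega>2, \<omega>3), \<omega>4) \<in> U \<Longrightarrow>
      (\<forall>\<omega>\<in>{\<omega>1, \<omega>2, \<omega>3, \<omega>4}. continuous_on {0..} (\<lambda>t. W t \<omega>)) \<Longrightarrow> chain x (\<omega>1, (\<omega>2, \<omega>3), \<omega>4)"
proof -
  interpret M4: prob_space M4 by (rule prob_space_M4)
  define p where "p = (small_ball_const x * small_ball_const 1 * (small_ball_const 0)\<^sup>2)\<^sup>2 / 41472"
  have p: "0 < p" by (simp add: p_def small_ball_const_def)
  define E where "E n = (\<Union>k\<in>{..<n} \<times> {..<n}. grid_chain x n k)" for n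
  define V where "V m = (\<Union>n\<in>{Suc m..}. E n)" for m
  have E [measurable]: "E n \<in> sets M4" for n unfolding E_def by measurable
  have V: "V m \<in> sets M4" for m unfolding V_def by measurable
  have "p \<le> measure M4 (V m)" for m
  proof -
    have "p \<le> measure M4 (E (Suc m))" unfolding p_def E_def by (rule prob_ex_grid_chain_ge) simp
    also have "\<dots> \<le> measure M4 (V m)" using V by (intro M4.finite_measure_mono) (auto simp: V_def)
    finally show ?thesis .
  qed
  moreover have "(\<lambda>m. measure M4 (V m)) \<longlonglongrightarrow> measure M4 (\<Inter>m. V m)"
    using V by (intro M4.finite_Lim_measure_decseq) (fastforce simp: decseq_def V_def)+
  ultimately have "p \<le> measure M4 (\<Inter>m. V m)" by (intro LIMSEQ_le_const) auto
  then have pos: "0 < measure M4 (\<Inter>m. V m)" using p by simp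
  show thesis
  proof (rule that[of "\<Inter>m. V m"])
    show "(\<Inter>m. V m) \<in> sets M4" using V by (intro sets.countable_INT) auto
    show "0 < measure M4 (\<Inter>m. V m)" by fact
    fix \<omega>1 \<omega>2 \<omega>3 \<omega>4
    assume mem: "(\<omega>1, (\<omega>2, \<omega>3), \<omega>4) \<in> (\<Inter>m. V m)"
      and "\<forall>\<omega>\<in>{\<omega>1, \<omega>2, \<omega>3, \<omega>4}. continuous_on {0..} (\<lambda>t. W t \<omega>)"
    then have cont: "continuous_on {1..2} (\<lambda>t. W t \<omega>1)" "continuous_on {1..2} (\<lambda>t. W t \<omega>2)"
      "continuous_on {1..2} (\<lambda>t. W t \<omega>3)" "continuous_on {1..2} (\<lambda>t. W t \<omega>4)"
      by (auto intro: continuous_on_subset[of "{0..}"])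
    let ?S = "{1..2} \<times> {1..2} :: (real \<times> real) set"
    define \<Psi> where "\<Psi> q = \<bar>W (fst q) \<omega>1 - x\<bar> + \<bar>W (fst q) \<omega>2 - W (snd q) \<omega>3\<bar> + \<bar>W (snd q) \<omega>4\<bar>" for q
    have "continuous_on ?S (\<lambda>q. W (fst q) \<omega>)" "continuous_on ?S (\<lambda>q. W (snd q) \<omega>)"
      if "continuous_on {1..2} (\<lambda>t. W t \<omega>)" for \<omega>
      by (rule continuous_on_compose2[OF that]; auto intro!: continuous_intros)+
    then have "continuous_on ?S \<Psi>"
      unfolding \<Psi>_def using cont by (intro continuous_intros) blast+
    moreover have "compact ?S" by (intro compact_Times) auto
    ultimately obtain q where q: "q \<in> ?S" "\<And>q'. q' \<in> ?S \<Longrightarrow> \<Psi> q \<le> \<Psi> q'"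
      using continuous_attains_inf[of ?S \<Psi>] by auto
    have "\<Psi> q \<le> 3 / sqrt (Suc m)" for m
    proof -
      from mem have "(\<omega>1, (\<omega>2, \<omega>3), \<omega>4) \<in> V m" by blast
      then obtain n where "Suc m \<le> n" "(\<omega>1, (\<omega>2, \<omega>3), \<omega>4) \<in> E n" unfolding V_def by auto
      then obtain i j where n: "Suc m \<le> n" "i < n" "j < n" "(\<omega>1, (\<omega>2, \<omega>3), \<omega>4) \<in> grid_chain x n (i, j)"
        unfolding E_def by auto
      then have "(grid n i, grid n j) \<in> ?S" by (auto simp: grid_def)
      then have "\<Psi> q \<le> \<Psi> (grid n i, grid n j)" by (rule q)
      also have "\<dots> \<le> 1 / sqrt n + 1 / sqrt n + 1 / sqrt n"
        using n(4) unfolding grid_chain_def grid_hit_def grid_meet_def \<Psi>_def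
        by (intro add_mono) auto
      also have "\<dots> = 3 / sqrt n" by simp
      also have "\<dots> \<le> 3 / sqrt (Suc m)" using n by (intro divide_left_mono) auto
      finally show ?thesis .
    qed
    moreover have "(\<lambda>m. 3 / sqrt (real (Suc m))) \<longlonglongrightarrow> 0" by real_asymp
    ultimately have "\<Psi> q \<le> 0" by (intro LIMSEQ_le_const) auto
    then have "W (fst q) \<omega>1 = x" "W (fst q) \<omega>2 = W (snd q) \<omega>3" "W (snd q) \<omega>4 = 0"
      unfolding \<Psi>_def by auto
    moreover have "fst q \<in> {1..2}" "snd q \<in> {1..2}" using q(1) by auto
    ultimately show "chain x (\<omega>1, (\<omega>2, \<omega>3), \<omega>4)"
      unfolding chain_def prod.case by blast
  qed
qed

text \<open>The four factors of full measure lose nothing. In the applications G also carries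
  pathwise properties of N, so all paths of a chain may be assumed to have them.\<close>

lemma chain_positive_on:
  assumes G: "G \<in> events" "prob G = 1" "\<And>\<omega>. \<omega> \<in> G \<Longrightarrow> continuous_on {0..} (\<lambda>t. W t \<omega>)"
  obtains V where "V \<in> sets M4" "0 < measure M4 V" "V \<subseteq> G \<times> ((G \<times> G) \<times> G)" "\<And>\<omega>. \<omega> \<in> V \<Longrightarrow> chain x \<omega>"
proof -
  interpret M4: prob_space M4 by (rule prob_space_M4)
  note G(1) [measurable]
  obtain U where U: "U \<in> sets M4" "0 < measure M4 U"
    "\<And>\<omega>1 \<omega>2 \<omega>3 \<omega>4. (\<omega>1, (\<omega>2, \<omega>3), \<omega>4) \<in> U \<Longrightarrow>
      (\<forall>\<omega>\<in>{\<omega>1, \<omega>2, \<omega>3, \<omega>4}. continuous_on {0..} (\<lambda>t. W t \<omega>)) \<Longrightarrow> chain x (\<omega>1, (\<omega>2, \<omega>3), \<omega>4)"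
    using chain_positive[of x] by blast
  define G4 where "G4 = G \<times> ((G \<times> G) \<times> G)"
  have G4: "G4 \<in> sets M4" unfolding G4_def by measurable
  have "measure M4 G4 = 1"
    unfolding G4_def by (simp add: measure_pair_Times prob_space_pair prob_space_axioms G)
  then have "AE \<omega> in M4. \<omega> \<in> G4" by (rule M4.AE_prob_1)
  then have "measure M4 U = measure M4 (U \<inter> G4)"
    using U G4 by (intro M4.finite_measure_eq_AE) auto
  moreover have "chain x \<omega>" if "\<omega> \<in> U \<inter> G4" for \<omega>
    using that G(3) U(3) by (cases \<omega>) (auto simp: G4_def)
  ultimately show thesis
    using that[of "U \<inter> G4"] U G4 by (auto simp: G4_def)
qed

end

section \<open>Borel measurability from right-continuity\<close>

text \<open>Approximating T from above by times with countably many values makes each evaluation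
  measurable, and right-continuity passes to the limit.\<close>

lemma measurable_right_continuous_eval:
  fixes Y :: "real \<Rightarrow> 'b \<Rightarrow> real"
  assumes Y: "\<And>t. 0 \<le> t \<Longrightarrow> Y t \<in> borel_measurable P"
    and rc: "\<And>\<omega> t. \<omega> \<in> space P \<Longrightarrow> 0 \<le> t \<Longrightarrow> continuous (at_right t) (\<lambda>s. Y s \<omega>)"
    and T [measurable]: "T \<in> borel_measurable P" and T0: "\<And>\<omega>. \<omega> \<in> space P \<Longrightarrow> 0 \<le> T \<omega>"
  shows "(\<lambda>\<omega>. Y (T \<omega>) \<omega>) \<in> borel_measurable P"
proof -
  \<comment> \<open>The successor makes \<open>\<tau> k\<close> strictly larger than T, as
    convergence along \<open>at_right\<close> demands.\<close>
  define \<tau> where "\<tau> k \<omega> = real (Suc (nat \<lfloor>2 ^ k * T \<omega>\<rfloor>)) / 2 ^ k" for k :: nat and \<omega>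
  show ?thesis
  proof (rule borel_measurable_LIMSEQ_real)
    fix k :: nat
    show "(\<lambda>\<omega>. Y (\<tau> k \<omega>) \<omega>) \<in> borel_measurable P"
      unfolding \<tau>_def
    proof (rule measurable_compose_countable[of "\<lambda>i. Y (real (Suc i) / 2 ^ k)"])
      show "Y (real (Suc i) / 2 ^ k) \<in> borel_measurable P" for i by (rule Y) simp
      show "(\<lambda>\<omega>. nat \<lfloor>2 ^ k * T \<omega>\<rfloor>) \<in> measurable P (count_space UNIV)" by measurable
    qed
  next
    fix \<omega> assume \<omega>: "\<omega> \<in> space P"
    have gt: "T \<omega> < \<tau> k \<omega>" for k
    proof -
      have "2 ^ k * T \<omega> < real (Suc (nat \<lfloor>2 ^ k * T \<omega>\<rfloor>))" by linarith
      then show ?thesis by (simp add: \<tau>_def pos_less_divide_eq mult.commute)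
    qed
    have "(\<lambda>k. \<tau> k \<omega>) \<longlonglongrightarrow> T \<omega>"
    proof (rule tendsto_sandwich)
      show "\<forall>\<^sub>F k in sequentially. T \<omega> \<le> \<tau> k \<omega>" using gt by (intro always_eventually) (auto intro: less_imp_le)
      show "\<forall>\<^sub>F k in sequentially. \<tau> k \<omega> \<le> T \<omega> + 1 / 2 ^ k"
      proof (rule always_eventually, rule)
        fix k :: nat
        have "0 \<le> 2 ^ k * T \<omega>" using T0[OF \<omega>] by simp
        then have "real (Suc (nat \<lfloor>2 ^ k * T \<omega>\<rfloor>)) \<le> 2 ^ k * T \<omega> + 1" by linarith
        then have "\<tau> k \<omega> \<le> (2 ^ k * T \<omega> + 1) / 2 ^ k" unfolding \<tau>_def by (intro divide_right_mono) auto
        also have "\<dots> = T \<omega> + 1 / 2 ^ k" by (simp add: field_simps)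
        finally show "\<tau> k \<omega> \<le> T \<omega> + 1 / 2 ^ k" .
      qed
      show "(\<lambda>k. T \<omega> + 1 / 2 ^ k) \<longlonglongrightarrow> T \<omega>" by real_asymp
    qed auto
    then have "filterlim (\<lambda>k. \<tau> k \<omega>) (at_right (T \<omega>)) sequentially"
      using gt less_imp_neq[OF gt, symmetric] by (auto simp: filterlim_at intro!: always_eventually)
    with rc[OF \<omega> T0[OF \<omega>]] show "(\<lambda>k. Y (\<tau> k \<omega>) \<omega>) \<longlonglongrightarrow> Y (T \<omega>) \<omega>"
      unfolding continuous_within by (rule filterlim_compose)
  qed
qed

text \<open>By compactness a nonnegative continuous function has a zero exactly when its infimum is
  0, and by density rational points detect this; only countable quantifiers remain.\<close>

lemma sets_ex_zero_unit_square:
  fixes H :: "real \<times> real \<Rightarrow> 'b \<Rightarrow> real"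
  assumes meas [measurable]: "\<And>q. q \<in> {0..1} \<times> {0..1} \<Longrightarrow> H q \<in> borel_measurable P"
    and cont: "\<And>\<omega>. \<omega> \<in> space P \<Longrightarrow> continuous_on ({0..1} \<times> {0..1}) (\<lambda>q. H q \<omega>)"
    and nonneg: "\<And>q \<omega>. 0 \<le> H q \<omega>"
  shows "{\<omega> \<in> space P. \<exists>q\<in>{0..1} \<times> {0..1}. H q \<omega> = 0} \<in> sets P"
proof -
  let ?S = "{0..1} \<times> {0..1} :: (real \<times> real) set"
  define R where "R = (\<rat> :: real set) \<inter> {0..1}"
  define D where "D = R \<times> R"
  have D: "countable D" "D \<subseteq> ?S" by (auto simp: D_def R_def countable_rat)
  have dense: "\<exists>r\<in>R. \<bar>r - u\<bar> < d" if "u \<in> {0..1}" "0 < d" for u d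
  proof -
    have "max 0 (u - d) < min 1 (u + d)" using that by auto
    from Rats_dense_in_real[OF this] obtain r where "r \<in> \<rat>" "max 0 (u - d) < r" "r < min 1 (u + d)" by blast
    then show ?thesis by (intro bexI[of _ r]) (auto simp: R_def)
  qed
  have iff: "(\<exists>q\<in>?S. H q \<omega> = 0) \<longleftrightarrow> (\<forall>k::nat. \<exists>q\<in>D. H q \<omega> < 1 / real (Suc k))" if \<omega>: "\<omega> \<in> space P" for \<omega>
  proof
    assume "\<exists>q\<in>?S. H q \<omega> = 0"
    then obtain q where q: "q \<in> ?S" "H q \<omega> = 0" by blast
    show "\<forall>k::nat. \<exists>q\<in>D. H q \<omega> < 1 / real (Suc k)"
    proof
      fix k :: nat
      obtain d where d: "0 < d" "\<And>q'. q' \<in> ?S \<Longrightarrow> dist q' q < d \<Longrightarrow> dist (H q' \<omega>) (H q \<omega>) < 1 / real (Suc k)"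
        using cont[OF \<omega>, unfolded continuous_on_iff, rule_format, OF q(1), of "1 / real (Suc k)"] by auto
      obtain r1 r2 where r: "r1 \<in> R" "\<bar>r1 - fst q\<bar> < d / 2" "r2 \<in> R" "\<bar>r2 - snd q\<bar> < d / 2"
        using dense[of "fst q" "d / 2"] dense[of "snd q" "d / 2"] q d by (auto simp: mem_Times_iff)
      have "dist (r1, r2) q \<le> \<bar>r1 - fst q\<bar> + \<bar>r2 - snd q\<bar>"
        unfolding dist_prod_def using sqrt_sum_squares_le_sum_abs[of "r1 - fst q" "r2 - snd q"]
        by (simp add: dist_real_def)
      then have "dist (r1, r2) q < d" using r by simp
      moreover have "(r1, r2) \<in> D" using r by (simp add: D_def)
      ultimately show "\<exists>q\<in>D. H q \<omega> < 1 / real (Suc k)"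
        using d(2)[of "(r1, r2)"] q(2) D(2) by (intro bexI[of _ "(r1, r2)"]) (auto simp: dist_real_def)
    qed
  next
    assume small: "\<forall>k::nat. \<exists>q\<in>D. H q \<omega> < 1 / real (Suc k)"
    have "compact ?S" by (intro compact_Times) auto
    then obtain q where q: "q \<in> ?S" "\<And>q'. q' \<in> ?S \<Longrightarrow> H q \<omega> \<le> H q' \<omega>"
      using continuous_attains_inf[OF _ _ cont[OF \<omega>]] by auto
    have "H q \<omega> \<le> 1 / real (Suc k)" for k
    proof -
      obtain q' where "q' \<in> D" "H q' \<omega> < 1 / real (Suc k)" using small by blast
      then show ?thesis using q(2)[of q'] D(2) by auto
    qed
    moreover have "(\<lambda>k. 1 / real (Suc k)) \<longlonglongrightarrow> 0" by real_asymp
    ultimately have "H q \<omega> \<le> 0" by (intro LIMSEQ_le_const) auto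
    with nonneg[of q \<omega>] q(1) show "\<exists>q\<in>?S. H q \<omega> = 0" by (intro bexI[of _ q]) auto
  qed
  have "{\<omega> \<in> space P. \<exists>q\<in>?S. H q \<omega> = 0} = {\<omega> \<in> space P. \<forall>k::nat. \<exists>q\<in>D. H q \<omega> < 1 / real (Suc k)}"
    by (intro Collect_cong conj_cong refl iff)
  also have "\<dots> \<in> sets P"
  proof (rule sets.sets_Collect_countable_All, rule sets.sets_Collect_countable_Ex'[OF _ D(1)])
    fix k :: nat and q assume "q \<in> D"
    then have [measurable]: "H q \<in> borel_measurable P" using D(2) by (intro meas) auto
    show "{\<omega> \<in> space P. H q \<omega> < 1 / real (Suc k)} \<in> sets P" by measurable
  qed
  finally show ?thesis .
qed

text \<open>T is the least first coordinate of a zero, attained by compactness. The event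
  \<open>T <= a\<close> says that a zero occurs on [1,a] x [1,2] or that there is none at all, and
  both are measurable after rescaling to the unit square.\<close>

lemma measurable_first_zero:
  fixes K :: "real \<Rightarrow> real \<Rightarrow> 'b \<Rightarrow> real"
  assumes meas: "\<And>t r. t \<in> {1..2} \<Longrightarrow> r \<in> {1..2} \<Longrightarrow> K t r \<in> borel_measurable P"
    and cont: "\<And>\<omega>. \<omega> \<in> space P \<Longrightarrow> continuous_on ({1..2} \<times> {1..2}) (\<lambda>q. K (fst q) (snd q) \<omega>)"
    and nonneg: "\<And>t r \<omega>. 0 \<le> K t r \<omega>"
  obtains T where "T \<in> borel_measurable P" "\<And>\<omega>. T \<omega> \<in> {1..2}"
    "\<And>\<omega>. \<omega> \<in> space P \<Longrightarrow> \<exists>t\<in>{1..2}. \<exists>r\<in>{1..2}. K t r \<omega> = 0 \<Longrightarrow> \<exists>r\<in>{1..2}. K (T \<omega>) r \<omega> = 0"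
    "{\<omega> \<in> space P. \<exists>t\<in>{1..2}. \<exists>r\<in>{1..2}. K t r \<omega> = 0} \<in> sets P"
proof -
  define Z where "Z \<omega> = {t \<in> {1..2}. \<exists>r\<in>{1..2}. K t r \<omega> = 0}" for \<omega>
  \<comment> \<open>The default 1 keeps T in [1,2] everywhere and puts the samples without zeros
    into every event \<open>T <= a\<close> with a >= 1.\<close>
  define T where "T \<omega> = (if \<omega> \<in> space P \<and> Z \<omega> \<noteq> {} then Inf (Z \<omega>) else 1)" for \<omega>
  have upto: "{\<omega> \<in> space P. \<exists>t\<in>{1..a}. \<exists>r\<in>{1..2}. K t r \<omega> = 0} \<in> sets P" if a: "a \<in> {1..2}" for a
  proof -
    \<comment> \<open>Affine map of the unit square onto [1,a] x [1,2]; for a = 1 it collapses the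
      first coordinate and is still onto.\<close>
    define H where "H q = K (1 + (a - 1) * fst q) (1 + snd q)" for q
    have inS: "(1 + (a - 1) * fst q, 1 + snd q) \<in> {1..a} \<times> {1..2}" if "q \<in> {0..1} \<times> {0..1}" for q :: "real \<times> real"
    proof -
      have "(a - 1) * fst q \<le> (a - 1) * 1" using a that by (intro mult_left_mono) auto
      then show ?thesis using a that by (auto simp: mem_Times_iff)
    qed
    have onto: "\<exists>q\<in>{0..1} \<times> {0..1}. H q = K t r" if "t \<in> {1..a}" "r \<in> {1..2}" for t r
    proof (cases "a = 1")
      case True
      then show ?thesis using that by (intro bexI[of _ "(0, r - 1)"]) (auto simp: H_def)
    next
      case False
      then show ?thesis using that a
        by (intro bexI[of _ "((t - 1) / (a - 1), r - 1)"]) (auto simp: H_def)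
    qed
    have "{\<omega> \<in> space P. \<exists>q\<in>{0..1} \<times> {0..1}. H q \<omega> = 0} \<in> sets P"
    proof (rule sets_ex_zero_unit_square)
      show "H q \<in> borel_measurable P" if "q \<in> {0..1} \<times> {0..1}" for q
        unfolding H_def using inS[OF that] a by (intro meas) auto
      show "continuous_on ({0..1} \<times> {0..1}) (\<lambda>q. H q \<omega>)" if "\<omega> \<in> space P" for \<omega>
      proof -
        have "continuous_on ({0..1} \<times> {0..1})
            (\<lambda>q. (\<lambda>q. K (fst q) (snd q) \<omega>) (1 + (a - 1) * fst q, 1 + snd q))"
          using inS a by (intro continuous_on_compose2[OF cont[OF that]] continuous_intros) force+
        then show ?thesis by (simp add: H_def)
      qed
    qed (simp add: H_def nonneg)
    also have "{\<omega> \<in> space P. \<exists>q\<in>{0..1} \<times> {0..1}. H q \<omega> = 0} = {\<omega> \<in> space P. \<exists>t\<in>{1..a}. \<exists>r\<in>{1..2}. K t r \<omega> = 0}"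
    proof -
      have "(\<exists>q\<in>{0..1} \<times> {0..1}. H q \<omega> = 0) \<longleftrightarrow> (\<exists>t\<in>{1..a}. \<exists>r\<in>{1..2}. K t r \<omega> = 0)" for \<omega>
      proof
        assume "\<exists>q\<in>{0..1} \<times> {0..1}. H q \<omega> = 0"
        then obtain q where "q \<in> {0..1} \<times> {0..1}" "H q \<omega> = 0" by blast
        then show "\<exists>t\<in>{1..a}. \<exists>r\<in>{1..2}. K t r \<omega> = 0"
          using inS[of q] by (auto simp: H_def simp del: atLeastAtMost_iff)
      next
        assume "\<exists>t\<in>{1..a}. \<exists>r\<in>{1..2}. K t r \<omega> = 0"
        then obtain t r where "t \<in> {1..a}" "r \<in> {1..2}" "K t r \<omega> = 0" by blast
        then show "\<exists>q\<in>{0..1} \<times> {0..1}. H q \<omega> = 0" using onto[of t r] by metis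
      qed
      then show ?thesis by simp
    qed
    finally show ?thesis .
  qed
  have compact: "compact (Z \<omega>)" if "\<omega> \<in> space P" for \<omega>
  proof -
    let ?S = "{1..2} \<times> {1..2} :: (real \<times> real) set"
    have S: "compact ?S" by (intro compact_Times) auto
    have "closed (?S \<inter> (\<lambda>q. K (fst q) (snd q) \<omega>) -` {0})"
      using cont[OF that] S by (intro continuous_closed_preimage) (auto intro: compact_imp_closed)
    then have "compact (?S \<inter> (\<lambda>q. K (fst q) (snd q) \<omega>) -` {0})"
      using compact_Int_closed[OF S, of "?S \<inter> (\<lambda>q. K (fst q) (snd q) \<omega>) -` {0}"] by (simp only: Int_left_absorb)
    then have "compact (fst ` (?S \<inter> (\<lambda>q. K (fst q) (snd q) \<omega>) -` {0}))"
      by (intro compact_continuous_image continuous_intros)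
    also have "fst ` (?S \<inter> (\<lambda>q. K (fst q) (snd q) \<omega>) -` {0}) = Z \<omega>"
      by (force simp: Z_def image_iff)
    finally show ?thesis .
  qed
  have Inf_mem: "Inf (Z \<omega>) \<in> Z \<omega>" and Inf_le: "\<And>t. t \<in> Z \<omega> \<Longrightarrow> Inf (Z \<omega>) \<le> t"
    if "\<omega> \<in> space P" "Z \<omega> \<noteq> {}" for \<omega>
    using compact[OF that(1)] that(2)
    by (auto intro!: closed_contains_Inf cInf_lower compact_imp_closed bounded_imp_bdd_below compact_imp_bounded)
  have T12: "T \<omega> \<in> {1..2}" for \<omega>
    using Inf_mem[of \<omega>] by (auto simp: T_def Z_def)
  have Z: "{\<omega> \<in> space P. Z \<omega> \<noteq> {}} \<in> sets P"
  proof -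
    have "Z \<omega> \<noteq> {} \<longleftrightarrow> (\<exists>t\<in>{1..2}. \<exists>r\<in>{1..2}. K t r \<omega> = 0)" for \<omega> by (auto simp: Z_def)
    moreover have "(2 :: real) \<in> {1..2}" by simp
    ultimately show ?thesis using upto[of 2] by (simp only:)
  qed
  show thesis
  proof (rule that)
    show "T \<in> borel_measurable P"
    proof (rule borel_measurableI_le)
      fix a :: real
      consider "a < 1" | "a \<in> {1..2}" | "2 < a" by force
      then show "{\<omega> \<in> space P. T \<omega> \<le> a} \<in> sets P"
      proof cases
        case 1
        then have "\<not> T \<omega> \<le> a" for \<omega> using T12[of \<omega>] by auto
        then show ?thesis by simp
      next
        case 2
        have "{\<omega> \<in> space P. T \<omega> \<le> a} = {\<omega> \<in> space P. \<exists>t\<in>{1..a}. \<exists>r\<in>{1..2}. K t r \<omega> = 0} \<union>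
            (space P - {\<omega> \<in> space P. Z \<omega> \<noteq> {}})"
        proof -
          have "T \<omega> \<le> a \<longleftrightarrow> (\<exists>t\<in>{1..a}. \<exists>r\<in>{1..2}. K t r \<omega> = 0) \<or> Z \<omega> = {}" if \<omega>: "\<omega> \<in> space P" for \<omega>
          proof (cases "Z \<omega> = {}")
            case False
            have "T \<omega> \<le> a \<longleftrightarrow> (\<exists>t\<in>Z \<omega>. t \<le> a)"
              using Inf_mem[OF \<omega> False] Inf_le[OF \<omega> False] False \<omega> by (auto simp: T_def intro: order_trans)
            also have "\<dots> \<longleftrightarrow> (\<exists>t\<in>{1..a}. \<exists>r\<in>{1..2}. K t r \<omega> = 0)"
              using 2 by (fastforce simp: Z_def)
            finally show ?thesis using False by simp
          qed (use 2 in \<open>simp add: T_def\<close>)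
          then show ?thesis by auto
        qed
        then show ?thesis using upto[OF 2] Z by auto
      next
        case 3
        then have "T \<omega> \<le> a" for \<omega> using T12[of \<omega>] by auto
        then show ?thesis by simp
      qed
    qed
    show "T \<omega> \<in> {1..2}" for \<omega> by fact
    show "\<exists>r\<in>{1..2}. K (T \<omega>) r \<omega> = 0" if "\<omega> \<in> space P" "\<exists>t\<in>{1..2}. \<exists>r\<in>{1..2}. K t r \<omega> = 0" for \<omega>
    proof -
      have "Z \<omega> \<noteq> {}" using that by (auto simp: Z_def)
      then show ?thesis using Inf_mem[of \<omega>] that by (auto simp: T_def Z_def)
    qed
    show "{\<omega> \<in> space P. \<exists>t\<in>{1..2}. \<exists>r\<in>{1..2}. K t r \<omega> = 0} \<in> sets P"
      by (rule upto) simp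
  qed
qed

context brownian
begin

text \<open>The function \<open>\<Phi>\<close> is jointly measurable and equals f(x) on the set E of
  good chains. Integrating over the paths in the slice of E at x, which has positive measure for
  every x, eliminates the paths and leaves f as a quotient of Borel functions. The values of
  \<open>m\<close> cancel inside \<open>\<Phi>\<close>.\<close>

lemma borel_measurable_of_right_continuous:
  fixes f m :: "real \<Rightarrow> real"
  assumes f: "\<And>x. f x \<noteq> 0" "f 0 = 1" and m: "\<And>t. 0 \<le> t \<Longrightarrow> m t \<noteq> 0"
    and meas: "\<And>t. 0 \<le> t \<Longrightarrow> (\<lambda>\<omega>. f (W t \<omega>) / m t) \<in> borel_measurable M"
    and rc: "right_continuous_process M (\<lambda>t \<omega>. f (W t \<omega>) / m t)"
  shows "f \<in> borel_measurable borel"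
proof -
  interpret M4: prob_space M4 by (rule prob_space_M4)
  let ?N = "\<lambda>t \<omega>. f (W t \<omega>) / m t"
  let ?P = "\<lambda>\<omega>. continuous_on {0..} (\<lambda>t. W t \<omega>) \<and> (\<forall>t\<ge>0. continuous (at_right t) (\<lambda>s. ?N s \<omega>))"
  have "AE \<omega> in M. ?P \<omega>"
    using AE_continuous rc unfolding right_continuous_process_def by eventually_elim blast
  then obtain G where G: "G \<in> events" "prob G = 1" "\<And>\<omega>. \<omega> \<in> G \<Longrightarrow> ?P \<omega>"
    by (rule AE_E_prob) auto
  note G(1) [measurable]
  \<comment> \<open>Constants replace the bad paths, because the selection lemmas want regularity at
    every sample point; E keeps only quadruples in G, where nothing was changed.\<close>
  define X where "X t \<omega> = (if \<omega> \<in> G then W t \<omega> else 0)" for t \<omega>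
  define Y where "Y t \<omega> = (if \<omega> \<in> G then ?N t \<omega> else 1)" for t \<omega>
  have X: "X t \<in> borel_measurable M" and Y: "Y t \<in> borel_measurable M" if "0 \<le> t" for t
  proof -
    note that[simp] meas[OF that, measurable]
    show "X t \<in> borel_measurable M" unfolding X_def by measurable
    show "Y t \<in> borel_measurable M" unfolding Y_def by measurable
  qed
  have X_cont: "continuous_on {0..} (\<lambda>t. X t \<omega>)" for \<omega>
    using G(3)[of \<omega>] by (cases "\<omega> \<in> G") (auto simp: X_def)
  have X_rc: "continuous (at_right t) (\<lambda>t. X t \<omega>)" if "0 \<le> t" for t \<omega>
    using X_cont[of \<omega>] that by (auto simp: continuous_on_eq_continuous_within intro: continuous_within_subset)
  have Y_rc: "continuous (at_right t) (\<lambda>t. Y t \<omega>)" if "0 \<le> t" for t \<omega>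
    using G(3)[of \<omega>] that by (cases "\<omega> \<in> G") (auto simp: Y_def)

  \<comment> \<open>The target x is a coordinate of the sample space, so that the selected times are
    measurable in x as well.\<close>
  let ?R = "borel \<Otimes>\<^sub>M M4"
  define w1 w2 w3 w4 where "w1 p = fst (snd p)" and "w2 p = fst (fst (snd (snd p)))"
    and "w3 p = snd (fst (snd (snd p)))" and "w4 p = snd (snd (snd p))" for p :: "real \<times> 'a \<times> ('a \<times> 'a) \<times> 'a"
  have w [measurable]: "w1 \<in> measurable ?R M" "w2 \<in> measurable ?R M" "w3 \<in> measurable ?R M" "w4 \<in> measurable ?R M"
    unfolding w1_def w2_def w3_def w4_def by measurable
  have Xw: "(\<lambda>p. X (T p) (w p)) \<in> borel_measurable ?R" and Yw: "(\<lambda>p. Y (T p) (w p)) \<in> borel_measurable ?R"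
    if "T \<in> borel_measurable ?R" "\<And>p. T p \<in> {1..2}" "w \<in> measurable ?R M" for T w
  proof -
    have T0: "0 \<le> T p" for p using that(2)[of p] by auto
    show "(\<lambda>p. X (T p) (w p)) \<in> borel_measurable ?R"
      by (rule measurable_right_continuous_eval[OF measurable_compose[OF that(3) X] X_rc that(1) T0])
    show "(\<lambda>p. Y (T p) (w p)) \<in> borel_measurable ?R"
      by (rule measurable_right_continuous_eval[OF measurable_compose[OF that(3) Y] Y_rc that(1) T0])
  qed
  define K where "K t r p = \<bar>X t (w1 p) - fst p\<bar> + \<bar>X t (w2 p) - X r (w3 p)\<bar> + \<bar>X r (w4 p)\<bar>" for t r p
  have X12: "continuous_on ({1..2} \<times> {1..2}) (\<lambda>q. X (fst q) \<omega>)" "continuous_on ({1..2} \<times> {1..2}) (\<lambda>q. X (snd q) \<omega>)" for \<omega>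
    by (rule continuous_on_compose2[OF X_cont]; auto intro!: continuous_intros)+
  have Xt [measurable]: "(\<lambda>p. X t (w p)) \<in> borel_measurable ?R" if "w \<in> measurable ?R M" "t \<in> {1..2}" for t w
    using that(2) by (intro measurable_compose[OF that(1) X]) auto
  obtain T where T: "T \<in> borel_measurable ?R" "\<And>p. T p \<in> {1..2}"
    "\<And>p. p \<in> space ?R \<Longrightarrow> \<exists>t\<in>{1..2}. \<exists>r\<in>{1..2}. K t r p = 0 \<Longrightarrow> \<exists>r\<in>{1..2}. K (T p) r p = 0"
    and Z: "{p \<in> space ?R. \<exists>t\<in>{1..2}. \<exists>r\<in>{1..2}. K t r p = 0} \<in> sets ?R"
  proof (rule measurable_first_zero[of K ?R])
    show "K t r \<in> borel_measurable ?R" if "t \<in> {1..2}" "r \<in> {1..2}" for t r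
      unfolding K_def using that w by (intro borel_measurable_add borel_measurable_abs borel_measurable_diff Xt) auto
    show "continuous_on ({1..2} \<times> {1..2}) (\<lambda>q. K (fst q) (snd q) p)" for p
      unfolding K_def by (intro continuous_intros X12)
  qed (auto simp: K_def)
  \<comment> \<open>Second selection, with T already inserted: r is now the variable to be
    minimised, and t is a dummy on which the function does not depend.\<close>
  obtain R where R: "R \<in> borel_measurable ?R" "\<And>p. R p \<in> {1..2}"
    "\<And>p. p \<in> space ?R \<Longrightarrow> \<exists>r\<in>{1..2}. \<exists>t\<in>{1..2::real}. K (T p) r p = 0 \<Longrightarrow> \<exists>t\<in>{1..2::real}. K (T p) (R p) p = 0"
  proof (rule measurable_first_zero[of "\<lambda>r t p. K (T p) r p" ?R])
    show "(\<lambda>p. K (T p) r p) \<in> borel_measurable ?R" if "r \<in> {1..2}" for r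
      unfolding K_def using that w T
      by (intro borel_measurable_add borel_measurable_abs borel_measurable_diff Xt Xw) auto
    show "continuous_on ({1..2} \<times> {1..2}) (\<lambda>q. K (T p) (fst q) p)" for p
      unfolding K_def by (intro continuous_intros X12)
  qed (auto simp: K_def)
  define \<Phi> where "\<Phi> p = Y (T p) (w1 p) / Y (T p) (w2 p) * (Y (R p) (w3 p) / Y (R p) (w4 p))" for p
  have \<Phi>_meas [measurable]: "\<Phi> \<in> borel_measurable ?R"
    unfolding \<Phi>_def using T R w by (intro borel_measurable_times borel_measurable_divide Yw)
  define E where "E = {p \<in> space ?R. \<exists>t\<in>{1..2}. \<exists>r\<in>{1..2}. K t r p = 0} \<inter>
    {p \<in> space ?R. w1 p \<in> G \<and> w2 p \<in> G \<and> w3 p \<in> G \<and> w4 p \<in> G}"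
  have E [measurable]: "E \<in> sets ?R" unfolding E_def using Z by (intro sets.Int) (assumption, measurable)
  have \<Phi>: "\<Phi> p = f (fst p)" if "p \<in> E" for p
  proof -
    have p: "p \<in> space ?R" "\<exists>t\<in>{1..2}. \<exists>r\<in>{1..2}. K t r p = 0" "w1 p \<in> G" "w2 p \<in> G" "w3 p \<in> G" "w4 p \<in> G"
      using that by (auto simp: E_def)
    have "\<exists>r\<in>{1..2}. \<exists>t\<in>{1..2::real}. K (T p) r p = 0"
      using T(3)[OF p(1,2)] by (auto intro: bexI[of _ 1])
    then have "K (T p) (R p) p = 0" using R(3)[OF p(1)] by blast
    then have "X (T p) (w1 p) = fst p" "X (T p) (w2 p) = X (R p) (w3 p)" "X (R p) (w4 p) = 0"
      unfolding K_def by auto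
    then have eq: "W (T p) (w1 p) = fst p" "W (T p) (w2 p) = W (R p) (w3 p)" "W (R p) (w4 p) = 0"
      using p by (auto simp: X_def)
    have "m (T p) \<noteq> 0" "m (R p) \<noteq> 0" using m[of "T p"] m[of "R p"] T(2)[of p] R(2)[of p] by auto
    then show ?thesis
      using p f by (simp add: \<Phi>_def Y_def eq)
  qed
  have slice: "0 < measure M4 (Pair x -` E)" for x
  proof -
    obtain V where V: "V \<in> sets M4" "0 < measure M4 V" "V \<subseteq> G \<times> ((G \<times> G) \<times> G)" "\<And>\<omega>. \<omega> \<in> V \<Longrightarrow> chain x \<omega>"
      using chain_positive_on[OF G(1,2)] G(3) by blast
    have "measure M4 V \<le> measure M4 (Pair x -` E)"
    proof (rule M4.finite_measure_mono)
      show "Pair x -` E \<in> sets M4" using E by (rule sets_Pair1)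
      show "V \<subseteq> Pair x -` E"
      proof
        fix \<omega> assume \<omega>: "\<omega> \<in> V"
        obtain \<omega>1 \<omega>2 \<omega>3 \<omega>4 where \<omega>_eq: "\<omega> = (\<omega>1, (\<omega>2, \<omega>3), \<omega>4)" by (metis surj_pair)
        have g: "\<omega>1 \<in> G" "\<omega>2 \<in> G" "\<omega>3 \<in> G" "\<omega>4 \<in> G" using \<omega> V(3) by (auto simp: \<omega>_eq)
        obtain t r where tr: "t \<in> {1..2}" "r \<in> {1..2}" "W t \<omega>1 = x" "W t \<omega>2 = W r \<omega>3" "W r \<omega>4 = 0"
          using V(4)[OF \<omega>] unfolding chain_def \<omega>_eq by auto
        then have K0: "K t r (x, \<omega>) = 0" using g by (simp add: K_def \<omega>_eq w1_def w2_def w3_def w4_def X_def)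
        have "\<exists>t\<in>{1..2}. \<exists>r\<in>{1..2}. K t r (x, \<omega>) = 0"
          using tr(1,2) K0 by blast
        moreover have "(x, \<omega>) \<in> space ?R"
          using \<omega> sets.sets_into_space[OF V(1)] by (auto simp: space_pair_measure)
        moreover have "w1 (x, \<omega>) \<in> G" "w2 (x, \<omega>) \<in> G" "w3 (x, \<omega>) \<in> G" "w4 (x, \<omega>) \<in> G"
          using g by (simp_all add: \<omega>_eq w1_def w2_def w3_def w4_def)
        ultimately show "\<omega> \<in> Pair x -` E" unfolding E_def by blast
      qed
    qed
    then show ?thesis using V(2) by simp
  qed
  \<comment> \<open>On the slice the integrand of g is the constant \<open>f x\<close>, so
    \<open>g x = h x * f x\<close>, and h is the positive measure of the slice.\<close>
  define g h where "g x = (\<integral>\<omega>. indicator E (x, \<omega>) * \<Phi> (x, \<omega>) \<partial>M4)" and "h x = (\<integral>\<omega>. (indicator E (x, \<omega>) :: real) \<partial>M4)"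
    for x :: real
  have integral_meas: "(\<lambda>x. \<integral>\<omega>. F (x, \<omega>) \<partial>M4) \<in> borel_measurable borel"
    if "F \<in> borel_measurable ?R" for F :: "_ \<Rightarrow> real"
    using M4.borel_measurable_lebesgue_integral[of "\<lambda>x \<omega>. F (x, \<omega>)" borel] that by simp
  have "g \<in> borel_measurable borel"
    unfolding g_def by (rule integral_meas[of "\<lambda>p. indicator E p * \<Phi> p"]) measurable
  moreover have "h \<in> borel_measurable borel"
    unfolding h_def by (rule integral_meas[of "indicator E"]) measurable
  ultimately have [measurable]: "g \<in> borel_measurable borel" "h \<in> borel_measurable borel" by auto
  have "f x = g x / h x" for x
  proof -
    have h: "h x = measure M4 (Pair x -` E)"
    proof -
      have "h x = (\<integral>\<omega>. indicator (Pair x -` E) \<omega> \<partial>M4)"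
        unfolding h_def by (intro Bochner_Integration.integral_cong) (auto split: split_indicator)
      also have "\<dots> = measure M4 (Pair x -` E)"
        using sets_Pair1[OF E, of x] sets.sets_into_space by (simp add: Int_absorb2)
      finally show ?thesis .
    qed
    have "g x = (\<integral>\<omega>. indicator E (x, \<omega>) * f x \<partial>M4)"
      unfolding g_def using \<Phi> by (intro Bochner_Integration.integral_cong) (auto split: split_indicator)
    also have "\<dots> = h x * f x" by (simp add: h_def)
    finally show ?thesis using slice[of x] h by simp
  qed
  then have "f = (\<lambda>x. g x / h x)" by auto
  then show ?thesis by simp
qed

end

section \<open>Positive eigenfunctions of the heat semigroup\<close>

text \<open>The transition operator of Brownian motion over time h, whose generator is half the
  second derivative.\<close>

definition heat :: "real \<Rightarrow> (real \<Rightarrow> real) \<Rightarrow> real \<Rightarrow> real" where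
  "heat h u x = (\<integral>y. normal_density x (sqrt h) y * u y \<partial>lborel)"

lemma has_bochner_integral_normal_shift:
  fixes v :: "real \<Rightarrow> real"
  assumes "has_bochner_integral lborel (\<lambda>y. normal_density 0 \<sigma> y * v (x + y)) I"
  shows "has_bochner_integral lborel (\<lambda>y. normal_density x \<sigma> y * v y) I"
proof -
  have "has_bochner_integral lborel (\<lambda>y. normal_density x \<sigma> (x + 1 * y) * v (x + 1 * y)) (I /\<^sub>R \<bar>1\<bar>)"
    using assms by (simp add: normal_density_def)
  then show ?thesis
    by (subst lborel_has_bochner_integral_real_affine_iff[of 1 _ _ x]) auto
qed

lemma has_bochner_integral_heat_cosh:
  assumes "0 < h"
  shows "has_bochner_integral lborel (\<lambda>y. normal_density x (sqrt h) y * cosh (c * y)) (exp (c\<^sup>2 * h / 2) * cosh (c * x))"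
proof (rule has_bochner_integral_normal_shift)
  let ?d = "normal_density 0 (sqrt h)"
  have h: "0 < sqrt h" using assms by simp
  have "has_bochner_integral lborel
      (\<lambda>y. cosh (c * x) * (?d y * cosh (c * y)) + sinh (c * x) * (?d y * sinh (c * y)))
      (cosh (c * x) * exp (c\<^sup>2 * (sqrt h)\<^sup>2 / 2) + sinh (c * x) * 0)"
    by (intro has_bochner_integral_add has_bochner_integral_mult_right
        has_bochner_integral_normal_cosh has_bochner_integral_normal_sinh h)
  then show "has_bochner_integral lborel (\<lambda>y. ?d y * cosh (c * (x + y))) (exp (c\<^sup>2 * h / 2) * cosh (c * x))"
    using assms by (simp add: cosh_add distrib_left mult_ac)
qed

text \<open>Supplies the quadratic perturbation for the maximum principle: the heat operator raises
  the square by exactly h.\<close>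

lemma has_bochner_integral_heat_square:
  assumes "0 < h"
  shows "has_bochner_integral lborel (\<lambda>y. normal_density x (sqrt h) y * y\<^sup>2) (x\<^sup>2 + h)"
proof (rule has_bochner_integral_normal_shift)
  let ?d = "normal_density 0 (sqrt h)"
  have h: "0 < sqrt h" using assms by simp
  have 0: "has_bochner_integral lborel ?d 1"
    using h by (simp add: has_bochner_integral_iff)
  have 1: "has_bochner_integral lborel (\<lambda>y. ?d y * y) 0"
    using normal_moment_nz_1[OF h, of 0] .
  have 2: "has_bochner_integral lborel (\<lambda>y. ?d y * y\<^sup>2) h"
    using normal_moment_even[OF h, of 0 1] assms by (simp add: fact_numeral)
  have "has_bochner_integral lborel (\<lambda>y. x\<^sup>2 * ?d y + 2 * x * (?d y * y) + ?d y * y\<^sup>2) (x\<^sup>2 * 1 + 2 * x * 0 + h)"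
    by (intro has_bochner_integral_add has_bochner_integral_mult_right 0 1 2)
  then show "has_bochner_integral lborel (\<lambda>y. ?d y * (x + y)\<^sup>2) (x\<^sup>2 + h)"
    by (simp add: power2_sum distrib_left mult_ac add_ac)
qed

text \<open>Beyond distance d the narrow Gaussian is a tiny multiple of the fixed unit Gaussian at
  the same centre, against which functions of large growth may still be integrable.\<close>

lemma normal_density_tail_le:
  assumes n: "1 \<le> n" and d: "d \<le> \<bar>y - x\<bar>" "0 \<le> d"
  shows "normal_density x (sqrt (1 / n)) y \<le> sqrt n * exp (- (d\<^sup>2 * (n - 1) / 2)) * normal_density x 1 y"
proof -
  have "d\<^sup>2 \<le> (y - x)\<^sup>2" using d power_mono[of d "\<bar>y - x\<bar>" 2] by simp
  then have "d\<^sup>2 * (n - 1) \<le> (y - x)\<^sup>2 * (n - 1)" using n by (intro mult_right_mono) auto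
  then have e: "exp (- ((y - x)\<^sup>2 * n / 2)) \<le> exp (- (d\<^sup>2 * (n - 1) / 2)) * exp (- ((y - x)\<^sup>2 / 2))"
  proof -
    have "- (p / 2) \<le> - (q / 2) + - (s / 2)" if "q \<le> p - s" for p q s :: real
      using that by simp
    note half = this
    show ?thesis
      unfolding mult_exp_exp exp_le_cancel_iff using \<open>d\<^sup>2 * (n - 1) \<le> (y - x)\<^sup>2 * (n - 1)\<close>
      by (intro half) (simp add: right_diff_distrib)
  qed
  have "normal_density x (sqrt (1 / n)) y = sqrt n / sqrt (2 * pi) * exp (- ((y - x)\<^sup>2 * n / 2))"
    using n by (simp add: normal_density_def real_sqrt_divide real_sqrt_mult field_simps)
  also have "\<dots> \<le> sqrt n / sqrt (2 * pi) * (exp (- (d\<^sup>2 * (n - 1) / 2)) * exp (- ((y - x)\<^sup>2 / 2)))"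
    using e n by (intro mult_left_mono) auto
  also have "\<dots> = sqrt n * exp (- (d\<^sup>2 * (n - 1) / 2)) * normal_density x 1 y"
    by (simp add: normal_density_def)
  finally show ?thesis .
qed

text \<open>At a positive interior maximum \<open>x0\<close> of \<open>u\<close>, \<open>heat h u x0 \<le> u x0\<close> up to the Gaussian tail beyond the
  interval, which is \<open>o(h)\<close>.\<close>

lemma heat_maximum_principle:
  fixes u :: "real \<Rightarrow> real"
  assumes cont: "continuous_on UNIV u" and e: "0 < e"
    and bdry: "u r \<le> 0" "u (- r) \<le> 0"
    and int: "\<And>x h. 0 < h \<Longrightarrow> integrable lborel (\<lambda>y. normal_density x (sqrt h) y * u y)"
    and sub: "\<And>x k. \<bar>x\<bar> < r \<Longrightarrow> 0 < u x \<Longrightarrow> u x + e / 2 ^ k \<le> heat (1 / 2 ^ k) u x"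
    and x: "\<bar>x\<bar> \<le> r"
  shows "u x \<le> 0"
proof (rule ccontr)
  assume ux: "\<not> u x \<le> 0"
  have "compact {-r..r}" "{-r..r} \<noteq> {}" using x by auto
  then obtain x0 where x0: "x0 \<in> {-r..r}" "\<And>y. y \<in> {-r..r} \<Longrightarrow> u y \<le> u x0"
    using continuous_attains_sup[of "{-r..r}" u] continuous_on_subset[OF cont] by blast
  have "x \<in> {-r..r}" using x by auto
  from x0(2)[OF this] ux have pos: "0 < u x0" by simp
  then have "x0 \<noteq> r" "x0 \<noteq> - r" using bdry by auto
  then have in0: "\<bar>x0\<bar> < r" using x0(1) by auto
  define d where "d = r - \<bar>x0\<bar>"
  have d: "0 < d" using in0 by (simp add: d_def)
  define C where "C = (\<integral>y. \<bar>normal_density x0 (sqrt 1) y * u y\<bar> \<partial>lborel)"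
  define \<theta> where "\<theta> n = sqrt n * exp (- (d\<^sup>2 * (n - 1) / 2))" for n
  have int1: "integrable lborel (\<lambda>y. \<bar>normal_density x0 (sqrt 1) y * u y\<bar>)"
    by (intro integrable_abs int) simp
  have key: "e \<le> C * (2 ^ k * \<theta> (2 ^ k))" for k :: nat
  proof -
    define h :: real where "h = 1 / 2 ^ k"
    have h: "0 < h" "0 < sqrt h" by (auto simp: h_def)
    have \<theta>0: "0 \<le> \<theta> (2 ^ k)" by (simp add: \<theta>_def)
    have "u x0 + e / 2 ^ k \<le> heat h u x0" using sub[OF in0 pos, of k] by (simp add: h_def)
    also have "\<dots> \<le> (\<integral>y. u x0 * normal_density x0 (sqrt h) y + \<theta> (2 ^ k) * \<bar>normal_density x0 (sqrt 1) y * u y\<bar> \<partial>lborel)"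
      unfolding heat_def
    proof (rule integral_mono)
      show "integrable lborel (\<lambda>y. normal_density x0 (sqrt h) y * u y)" using h by (intro int)
      show "integrable lborel (\<lambda>y. u x0 * normal_density x0 (sqrt h) y + \<theta> (2 ^ k) * \<bar>normal_density x0 (sqrt 1) y * u y\<bar>)"
        using int1 h by (intro Bochner_Integration.integrable_add integrable_mult_right) auto
      fix y
      show "normal_density x0 (sqrt h) y * u y \<le> u x0 * normal_density x0 (sqrt h) y + \<theta> (2 ^ k) * \<bar>normal_density x0 (sqrt 1) y * u y\<bar>"
      proof (cases "\<bar>y - x0\<bar> < d")
        case True
        then have "y \<in> {-r..r}" by (auto simp: d_def)
        then have "normal_density x0 (sqrt h) y * u y \<le> normal_density x0 (sqrt h) y * u x0"
          by (intro mult_left_mono x0(2)) auto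
        then show ?thesis using \<theta>0 by (simp add: mult.commute add_increasing2)
      next
        case False
        have "normal_density x0 (sqrt h) y * u y \<le> normal_density x0 (sqrt h) y * \<bar>u y\<bar>"
          by (intro mult_left_mono) auto
        also have "\<dots> \<le> (\<theta> (2 ^ k) * normal_density x0 1 y) * \<bar>u y\<bar>"
          unfolding h_def \<theta>_def using False d by (intro mult_right_mono normal_density_tail_le) auto
        finally show ?thesis using pos by (simp add: abs_mult mult.assoc add_increasing)
      qed
    qed
    also have "\<dots> = u x0 + \<theta> (2 ^ k) * C"
      using int1 h by (subst Bochner_Integration.integral_add) (auto simp: C_def)
    finally have "e / 2 ^ k \<le> \<theta> (2 ^ k) * C" by simp
    then show ?thesis by (simp add: field_simps)
  qed
  have "((\<lambda>n. n * \<theta> n) \<longlongrightarrow> 0) at_top"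
    unfolding \<theta>_def using d by real_asymp
  moreover have "filterlim (\<lambda>k. 2 ^ k :: real) at_top sequentially" by real_asymp
  ultimately have "(\<lambda>k. 2 ^ k * \<theta> (2 ^ k)) \<longlonglongrightarrow> 0" by (rule filterlim_compose)
  then have "(\<lambda>k. C * (2 ^ k * \<theta> (2 ^ k))) \<longlonglongrightarrow> C * 0" by (intro tendsto_intros)
  then have "e \<le> C * 0" using key by (intro LIMSEQ_le_const) auto
  then show False using e by simp
qed

text \<open>The multiple A of cosh that agrees with g at r agrees at -r too, by evenness. With
  eigenvalue at least 1, neither sign of the difference can have a positive interior maximum once a
  small quadratic has made the inequality strict. Evaluation at 0 then identifies A.\<close>

lemma heat_eigenfunction_eq_cosh:
  fixes g :: "real \<Rightarrow> real"
  assumes cont: "continuous_on UNIV g" and even: "\<And>x. g (- x) = g x"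
    and int: "\<And>x h. 0 < h \<Longrightarrow> integrable lborel (\<lambda>y. normal_density x (sqrt h) y * g y)"
    and eig: "\<And>x k. heat (1 / 2 ^ k) g x = exp (c\<^sup>2 / 2 / 2 ^ k) * g x"
  shows "g x = g 0 * cosh (c * x)"
proof -
  have nonneg: "g r = g 0 * cosh (c * r)" if r: "0 \<le> r" for r
  proof -
    define A where "A = g r / cosh (c * r)"
    have le: "s * (g x - A * cosh (c * x)) \<le> e * (r\<^sup>2 - x\<^sup>2)" if s: "s = 1 \<or> s = - 1" and e: "0 < e" and x: "\<bar>x\<bar> \<le> r" for s e x
    proof -
      \<comment> \<open>The quadratic vanishes at the endpoints, is at most 0 between them, and
        gains exactly \<open>e * h\<close> under \<open>heat h\<close>; s selects the upper or the
        lower bound.\<close>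
      define u where "u x = s * (g x - A * cosh (c * x)) + e * (x\<^sup>2 - r\<^sup>2)" for x
      have hb: "has_bochner_integral lborel (\<lambda>y. normal_density x (sqrt h) y * u y)
          (s * (heat h g x - A * (exp (c\<^sup>2 * h / 2) * cosh (c * x))) + e * (x\<^sup>2 + h - r\<^sup>2 * 1))" if h: "0 < h" for x h
      proof -
        let ?d = "normal_density x (sqrt h)"
        have d: "has_bochner_integral lborel ?d 1" using h by (simp add: has_bochner_integral_iff)
        have g: "has_bochner_integral lborel (\<lambda>y. ?d y * g y) (heat h g x)"
          using int[OF h] by (simp add: has_bochner_integral_iff heat_def)
        have "has_bochner_integral lborel
            (\<lambda>y. s * (?d y * g y - A * (?d y * cosh (c * y))) + e * (?d y * y\<^sup>2 - r\<^sup>2 * ?d y))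
            (s * (heat h g x - A * (exp (c\<^sup>2 * h / 2) * cosh (c * x))) + e * (x\<^sup>2 + h - r\<^sup>2 * 1))"
          by (intro has_bochner_integral_add has_bochner_integral_diff has_bochner_integral_mult_right d g
              has_bochner_integral_heat_cosh has_bochner_integral_heat_square h)
        moreover have "s * (?d y * g y - A * (?d y * cosh (c * y))) + e * (?d y * y\<^sup>2 - r\<^sup>2 * ?d y) = ?d y * u y" for y
          by (simp add: u_def algebra_simps)
        ultimately show ?thesis by simp
      qed
      have "u x \<le> 0"
      proof (rule heat_maximum_principle[where u=u and r=r, OF _ e])
        show "continuous_on UNIV u" unfolding u_def by (intro continuous_intros cont)
        show "u r \<le> 0" "u (- r) \<le> 0" by (simp_all add: u_def A_def even)
        show "integrable lborel (\<lambda>y. normal_density x (sqrt h) y * u y)" if "0 < h" for x h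
          using hb[OF that] by (simp add: has_bochner_integral_iff)
        show "u y + e / 2 ^ k \<le> heat (1 / 2 ^ k) u y" if y: "\<bar>y\<bar> < r" and uy: "0 < u y" for y k
        proof -
          let ?E = "exp (c\<^sup>2 / 2 / 2 ^ k)" and ?v = "s * (g y - A * cosh (c * y))"
          have "y\<^sup>2 \<le> r\<^sup>2" using y abs_le_square_iff[of y r] by auto
          then have "e * (y\<^sup>2 - r\<^sup>2) \<le> 0" using e by (simp add: mult_nonneg_nonpos)
          then have v: "0 < ?v" using uy unfolding u_def by linarith
          have "heat (1 / 2 ^ k) u y =
              s * (heat (1 / 2 ^ k) g y - A * (exp (c\<^sup>2 * (1 / 2 ^ k) / 2) * cosh (c * y))) + e * (y\<^sup>2 + 1 / 2 ^ k - r\<^sup>2 * 1)"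
            using hb[of "1 / 2 ^ k" y] by (simp add: has_bochner_integral_iff heat_def)
          also have "\<dots> = ?E * ?v + e * (y\<^sup>2 - r\<^sup>2) + e / 2 ^ k"
            unfolding eig by (simp add: algebra_simps)
          finally have "heat (1 / 2 ^ k) u y = ?E * ?v + e * (y\<^sup>2 - r\<^sup>2) + e / 2 ^ k" .
          \<comment> \<open>The eigenvalue is at least 1 as c is real, and \<open>?v\<close> is
            positive because u is positive there while its quadratic part is at most 0.\<close>
          moreover have "1 * ?v \<le> ?E * ?v" using v by (intro mult_right_mono) auto
          ultimately show ?thesis by (simp add: u_def)
        qed
      qed fact
      then show ?thesis unfolding u_def by (simp add: algebra_simps)
    qed
    have "s * (g 0 - A) \<le> 0" if "s = 1 \<or> s = - 1" for s
    proof (rule field_le_epsilon)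
      fix e :: real assume e: "0 < e"
      \<comment> \<open>Dividing by \<open>r^2 + 1\<close> keeps the perturbation at 0 below e, also
        when r = 0.\<close>
      have "s * (g 0 - A * cosh (c * 0)) \<le> e / (r\<^sup>2 + 1) * (r\<^sup>2 - 0\<^sup>2)"
        using e r by (intro le that) (auto simp: add_nonneg_pos)
      also have "\<dots> \<le> e" using e by (simp add: pos_divide_le_eq add_nonneg_pos distrib_left)
      finally show "s * (g 0 - A) \<le> 0 + e" by simp
    qed
    from this[of 1] this[of "- 1"] have "g 0 = A" by simp
    then show ?thesis by (simp add: A_def)
  qed
  show ?thesis using nonneg[of x] nonneg[of "- x"] even[of x] by (cases "0 \<le> x") auto
qed

text \<open>From y^2 <= 2 (y - x)^2 + 2 x^2: doubling the variance absorbs a bounded shift of the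
  centre. Integrability against all centred Gaussians thus yields it for every centre, with a
  dominating function for locally bounded shifts.\<close>

lemma normal_density_shift_le:
  assumes h: "0 < h" and B: "\<bar>x\<bar> \<le> B"
  shows "normal_density x (sqrt h) y \<le> sqrt 2 * exp (B\<^sup>2 / (2 * h)) * normal_density 0 (sqrt (2 * h)) y"
proof -
  have "x\<^sup>2 \<le> B\<^sup>2" using B abs_le_square_iff[of x B] by auto
  moreover have "y\<^sup>2 \<le> 2 * (y - x)\<^sup>2 + 2 * x\<^sup>2"
    using sum_squares_ge_zero[of "y - 2 * x" 0] by (simp add: power2_eq_square algebra_simps)
  ultimately have "y\<^sup>2 / (4 * h) \<le> (2 * (y - x)\<^sup>2 + 2 * B\<^sup>2) / (4 * h)"
    using h by (intro divide_right_mono) auto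
  then have "- (y - x)\<^sup>2 / (2 * h) \<le> B\<^sup>2 / (2 * h) + - y\<^sup>2 / (4 * h)"
    using h by (simp add: field_simps)
  then have e: "exp (- (y - x)\<^sup>2 / (2 * h)) \<le> exp (B\<^sup>2 / (2 * h)) * exp (- y\<^sup>2 / (4 * h))"
    unfolding mult_exp_exp exp_le_cancel_iff .
  have "normal_density x (sqrt h) y = 1 / sqrt (2 * pi * h) * exp (- (y - x)\<^sup>2 / (2 * h))"
    using h by (simp add: normal_density_def)
  also have "\<dots> \<le> 1 / sqrt (2 * pi * h) * (exp (B\<^sup>2 / (2 * h)) * exp (- y\<^sup>2 / (4 * h)))"
    using e h by (intro mult_left_mono) auto
  also have "1 / sqrt (2 * pi * h) = sqrt 2 * (1 / sqrt (2 * pi * (2 * h)))"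
    using h by (simp add: real_sqrt_mult field_simps)
  finally show ?thesis using h by (simp add: normal_density_def mult_ac)
qed

lemma integrable_normal_density_shift:
  fixes u :: "real \<Rightarrow> real"
  assumes [measurable]: "u \<in> borel_measurable borel"
    and int: "\<And>h. 0 < h \<Longrightarrow> integrable lborel (\<lambda>y. normal_density 0 (sqrt h) y * u y)"
    and h: "0 < h"
  shows "integrable lborel (\<lambda>y. normal_density x (sqrt h) y * u y)"
proof (rule Bochner_Integration.integrable_bound)
  show "integrable lborel (\<lambda>y. sqrt 2 * exp (\<bar>x\<bar>\<^sup>2 / (2 * h)) * (normal_density 0 (sqrt (2 * h)) y * u y))"
    using h by (intro integrable_mult_right int) simp
  show "AE y in lborel. norm (normal_density x (sqrt h) y * u y) \<le>
      norm (sqrt 2 * exp (\<bar>x\<bar>\<^sup>2 / (2 * h)) * (normal_density 0 (sqrt (2 * h)) y * u y))"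
    using mult_right_mono[OF normal_density_shift_le[OF h order_refl], of "\<bar>u _\<bar>" x]
    by (intro AE_I2) (simp add: abs_mult mult.assoc)
qed simp

lemma continuous_on_heat:
  fixes u :: "real \<Rightarrow> real"
  assumes [measurable]: "u \<in> borel_measurable borel"
    and int: "\<And>h. 0 < h \<Longrightarrow> integrable lborel (\<lambda>y. normal_density 0 (sqrt h) y * u y)"
    and h: "0 < h"
  shows "continuous_on UNIV (heat h u)"
  unfolding continuous_on_eq_continuous_within continuous_within_sequentially comp_def
proof safe
  fix x :: real and X :: "nat \<Rightarrow> real" assume X: "X \<longlonglongrightarrow> x"
  then obtain B where B: "\<And>n. \<bar>X n\<bar> \<le> B"
    using convergent_imp_Bseq[of X] by (auto simp: convergent_def Bseq_def)
  show "(\<lambda>n. heat h u (X n)) \<longlonglongrightarrow> heat h u x"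
    unfolding heat_def
  proof (rule integral_dominated_convergence)
    show "integrable lborel (\<lambda>y. \<bar>sqrt 2 * exp (B\<^sup>2 / (2 * h)) * (normal_density 0 (sqrt (2 * h)) y * u y)\<bar>)"
      using h by (intro integrable_abs integrable_mult_right int) simp
    show "AE y in lborel. norm (normal_density (X n) (sqrt h) y * u y) \<le>
        \<bar>sqrt 2 * exp (B\<^sup>2 / (2 * h)) * (normal_density 0 (sqrt (2 * h)) y * u y)\<bar>" for n
      using mult_right_mono[OF normal_density_shift_le[OF h B], of "\<bar>u _\<bar>" n]
      by (intro AE_I2) (simp add: abs_mult mult.assoc)
    show "AE y in lborel. (\<lambda>n. normal_density (X n) (sqrt h) y * u y) \<longlonglongrightarrow> normal_density x (sqrt h) y * u y"
      unfolding normal_density_def using h by (intro AE_I2 tendsto_intros X) auto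
  qed simp_all
qed

lemma continuous_AE_eq:
  fixes F G :: "real \<Rightarrow> real"
  assumes "continuous_on UNIV F" "continuous_on UNIV G" "AE x in lborel. F x = G x"
  shows "F x = G x"
proof -
  have op: "open {x. F x \<noteq> G x}"
    using assms by (intro open_Collect_neq) auto
  then have "(AE x in lborel. F x = G x) \<longleftrightarrow> {x \<in> space lborel. F x \<noteq> G x} \<in> null_sets lborel"
    by (intro AE_iff_null) auto
  then have "negligible {x. F x \<noteq> G x}"
    using assms(3) by (simp add: negligible_iff_null_sets null_sets_completionI)
  with op show ?thesis using open_not_negligible by blast
qed

context brownian
begin

text \<open>Independence makes the joint law a product; for nonnegative integrals Tonelli
  suffices.\<close>

lemma nn_integral_W_increment:
  assumes s: "0 < s" and h: "0 < h" and [measurable]: "F \<in> borel_measurable (borel \<Otimes>\<^sub>M borel)"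
  shows "(\<integral>\<^sup>+\<omega>. F (W s \<omega>, W (s + h) \<omega> - W s \<omega>) \<partial>M) =
    (\<integral>\<^sup>+x. ennreal (normal_density 0 (sqrt s) x) * (\<integral>\<^sup>+y. ennreal (normal_density 0 (sqrt h) y) * F (x, y) \<partial>lborel) \<partial>lborel)"
proof -
  let ?I = "\<lambda>\<omega>. W (s + h) \<omega> - W s \<omega>"
  have [measurable]: "W s \<in> borel_measurable M" "W (s + h) \<in> borel_measurable M" using s h by auto
  have ind: "indep_var borel (W s) borel ?I"
    using s h by (intro indep_var_past_increment W_measurable_\<F>) auto
  have dW: "distr M borel (W s) = density lborel (\<lambda>x. ennreal (normal_density 0 (sqrt s) x))"
    using distributed_W[OF s] by (simp add: distributed_def cong: distr_cong)
  have dI: "distr M borel ?I = density lborel (\<lambda>x. ennreal (normal_density 0 (sqrt h) x))"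
    using distributed_increment[of s "s + h"] s h by (simp add: distributed_def cong: distr_cong)
  interpret I: prob_space "distr M borel ?I" by (rule prob_space_distr) measurable
  have "(\<integral>\<^sup>+\<omega>. F (W s \<omega>, ?I \<omega>) \<partial>M) = (\<integral>\<^sup>+p. F p \<partial>distr M (borel \<Otimes>\<^sub>M borel) (\<lambda>\<omega>. (W s \<omega>, ?I \<omega>)))"
    by (subst nn_integral_distr) auto
  also have "distr M (borel \<Otimes>\<^sub>M borel) (\<lambda>\<omega>. (W s \<omega>, ?I \<omega>)) = distr M borel (W s) \<Otimes>\<^sub>M distr M borel ?I"
    using ind unfolding indep_var_distribution_eq by simp
  also have "(\<integral>\<^sup>+p. F p \<partial>(distr M borel (W s) \<Otimes>\<^sub>M distr M borel ?I)) =
      (\<integral>\<^sup>+x. \<integral>\<^sup>+y. F (x, y) \<partial>distr M borel ?I \<partial>distr M borel (W s))"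
    by (rule I.nn_integral_fst[symmetric]) (simp cong: measurable_cong_sets sets_pair_measure_cong)
  also have "\<dots> = (\<integral>\<^sup>+x. \<integral>\<^sup>+y. ennreal (normal_density 0 (sqrt h) y) * F (x, y) \<partial>lborel \<partial>distr M borel (W s))"
    unfolding dI by (intro nn_integral_cong nn_integral_density) auto
  also have "\<dots> = (\<integral>\<^sup>+x. ennreal (normal_density 0 (sqrt s) x) * (\<integral>\<^sup>+y. ennreal (normal_density 0 (sqrt h) y) * F (x, y) \<partial>lborel) \<partial>lborel)"
    unfolding dW by (intro nn_integral_density) measurable
  finally show ?thesis .
qed

end

section \<open>From the martingale to the hyperbolic cosine\<close>

locale even_martingale = brownian +
  fixes f :: "real \<Rightarrow> real"
  assumes f_measurable [measurable]: "f \<in> borel_measurable borel"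
    and f_pos: "0 < f x" and f_even: "f (- x) = f x" and f_0: "f 0 = 1"
    and f_integrable: "0 \<le> t \<Longrightarrow> integrable M (\<lambda>\<omega>. f (W t \<omega>))"
    and f_martingale: "martingale M \<F> (\<lambda>t \<omega>. f (W t \<omega>) / (\<integral>\<omega>'. f (W t \<omega>') \<partial>M))"
    and f_right_continuous: "right_continuous_process M (\<lambda>t \<omega>. f (W t \<omega>) / (\<integral>\<omega>'. f (W t \<omega>') \<partial>M))"
begin

section \<open>The expectation of f along W as a heat integral\<close>

definition m :: "real \<Rightarrow> real" where
  "m t = (\<integral>\<omega>. f (W t \<omega>) \<partial>M)"

lemma m_pos: "0 \<le> t \<Longrightarrow> 0 < m t"
  unfolding m_def using f_pos by (intro expectation_greater f_integrable) auto

lemma integrable_normal_f: "0 < h \<Longrightarrow> integrable lborel (\<lambda>y. normal_density 0 (sqrt h) y * f y)"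
  using distributed_integrable[OF distributed_W, of h f] f_integrable[of h] by simp

lemmas integrable_heat_f = integrable_normal_density_shift[OF f_measurable integrable_normal_f]
  and continuous_on_heat_f = continuous_on_heat[OF f_measurable integrable_normal_f]

lemma m_eq_heat: "0 < t \<Longrightarrow> m t = heat t f 0"
  using distributed_integral[OF distributed_W, of t f] by (simp add: m_def heat_def)

lemma heat_f_nn_integral:
  assumes "0 < h"
  shows "(\<integral>\<^sup>+y. ennreal (normal_density 0 (sqrt h) y) * ennreal (f (x + y)) \<partial>lborel) = ennreal (heat h f x)"
proof -
  have "ennreal (heat h f x) = (\<integral>\<^sup>+y. ennreal (normal_density x (sqrt h) y * f y) \<partial>lborel)"
    unfolding heat_def
    by (intro nn_integral_eq_integral[symmetric] integrable_heat_f assms AE_I2 mult_nonneg_nonneg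
        normal_density_nonneg less_imp_le[OF f_pos])
  also have "\<dots> = (\<integral>\<^sup>+y. ennreal (normal_density x (sqrt h) (x + 1 * y) * f (x + 1 * y)) \<partial>lborel)"
    by (subst nn_integral_real_affine[of _ 1 x]) auto
  also have "\<dots> = (\<integral>\<^sup>+y. ennreal (normal_density 0 (sqrt h) y) * ennreal (f (x + y)) \<partial>lborel)"
    by (intro nn_integral_cong) (simp add: normal_density_def ennreal_mult' flip: ennreal_mult')
  finally show ?thesis ..
qed

text \<open>The martingale property is tested only on events determined by \<open>W s\<close>; these
  suffice because the aim is an identity between functions of the current position.\<close>

lemma martingale_nn_integral:
  assumes s: "0 < s" and h: "0 < h" and B: "B \<in> sets borel"
  shows "(\<integral>\<^sup>+\<omega>. indicator B (W s \<omega>) * ennreal (f (W (s + h) \<omega>)) \<partial>M) =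
    (\<integral>\<^sup>+\<omega>. indicator B (W s \<omega>) * ennreal (m (s + h) / m s * f (W s \<omega>)) \<partial>M)"
proof -
  have [measurable]: "W s \<in> borel_measurable M" "W (s + h) \<in> borel_measurable M" "B \<in> sets borel" using s h B by auto
  define A where "A = W s -` B \<inter> space M"
  have A: "A \<in> sets (\<F> s)" unfolding A_def using W_measurable_\<F>[of s s] s B
    by (metis less_imp_le measurable_sets order_refl space_\<F>)
  have AM: "A \<in> events" unfolding A_def by measurable
  interpret finite_measure_subalgebra M "\<F> s"
    by unfold_locales (rule subalgebra_\<F>)
  let ?N = "\<lambda>t \<omega>. f (W t \<omega>) / (\<integral>\<omega>'. f (W t \<omega>') \<partial>M)"
  have N: "integrable M (?N t)" if "0 \<le> t" for t
    using f_martingale that by (auto simp: martingale_def)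
  have "(\<integral>\<omega>\<in>A. ?N (s + h) \<omega> \<partial>M) = (\<integral>\<omega>\<in>A. real_cond_exp M (\<F> s) (?N (s + h)) \<omega> \<partial>M)"
    using s h by (intro real_cond_exp_intA N A) auto
  also have "\<dots> = (\<integral>\<omega>\<in>A. ?N s \<omega> \<partial>M)"
  proof -
    have "AE \<omega> in M. real_cond_exp M (\<F> s) (?N (s + h)) \<omega> = ?N s \<omega>"
      using f_martingale s h by (simp add: martingale_def)
    then show ?thesis
      unfolding set_lebesgue_integral_def using AM
      by (intro integral_cong_AE) (auto intro: borel_measurable_integrable)
  qed
  finally have "(\<integral>\<omega>. indicator A \<omega> * f (W (s + h) \<omega>) \<partial>M) / m (s + h) = (\<integral>\<omega>. indicator A \<omega> * f (W s \<omega>) \<partial>M) / m s"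
    by (simp add: set_lebesgue_integral_def m_def)
  then have eq: "(\<integral>\<omega>. indicator A \<omega> * f (W (s + h) \<omega>) \<partial>M) = (\<integral>\<omega>. indicator A \<omega> * (m (s + h) / m s * f (W s \<omega>)) \<partial>M)"
  proof -
    have "(\<integral>\<omega>. indicator A \<omega> * (m (s + h) / m s * f (W s \<omega>)) \<partial>M) =
        m (s + h) / m s * (\<integral>\<omega>. indicator A \<omega> * f (W s \<omega>) \<partial>M)"
      by (subst integral_mult_right_zero[symmetric], intro Bochner_Integration.integral_cong) (simp_all add: mult_ac)
    then show ?thesis
      using \<open>_ / m (s + h) = _\<close> m_pos[of s] m_pos[of "s + h"] s h by (simp add: field_simps)
  qed
  have nn: "(\<integral>\<^sup>+\<omega>. indicator B (W s \<omega>) * ennreal (g \<omega>) \<partial>M) = ennreal (\<integral>\<omega>. indicator A \<omega> * g \<omega> \<partial>M)"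
    if "integrable M g" "\<And>\<omega>. 0 \<le> g \<omega>" for g
  proof -
    have "(\<integral>\<^sup>+\<omega>. indicator B (W s \<omega>) * ennreal (g \<omega>) \<partial>M) = (\<integral>\<^sup>+\<omega>. ennreal (indicator A \<omega> * g \<omega>) \<partial>M)"
      by (intro nn_integral_cong) (auto simp: A_def split: split_indicator)
    also have "\<dots> = ennreal (\<integral>\<omega>. indicator A \<omega> * g \<omega> \<partial>M)"
      using that integrable_real_mult_indicator[OF AM that(1)]
      by (intro nn_integral_eq_integral) (auto simp: mult.commute)
    finally show ?thesis .
  qed
  show ?thesis
    using s h m_pos[of s] m_pos[of "s + h"] f_pos
    by (simp add: nn f_integrable eq less_imp_le)
qed

text \<open>Both sides, weighted with the density of \<open>W s\<close>, have the same integral over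
  every Borel set. Uniqueness of densities gives equality almost everywhere, and the Gaussian weight
  is strictly positive.\<close>

lemma AE_heat_f:
  assumes s: "0 < s" and h: "0 < h"
  shows "AE x in lborel. heat h f x = m (s + h) / m s * f x"
proof -
  define r where "r = m (s + h) / m s"
  have r: "0 < r" unfolding r_def using m_pos s h by simp
  have [measurable]: "heat h f \<in> borel_measurable borel"
    using continuous_on_heat_f[OF _ h] by (intro borel_measurable_continuous_onI)
  let ?d = "\<lambda>x. ennreal (normal_density 0 (sqrt s) x)"
  have "density lborel (\<lambda>x. ?d x * ennreal (heat h f x)) = density lborel (\<lambda>x. ?d x * ennreal (r * f x))"
  proof (rule measure_eqI)
    fix B assume "B \<in> sets (density lborel (\<lambda>x. ?d x * ennreal (heat h f x)))"
    then have [measurable]: "B \<in> sets borel" by simp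
    have "emeasure (density lborel (\<lambda>x. ?d x * ennreal (heat h f x))) B =
        (\<integral>\<^sup>+x. ?d x * (indicator B x * ennreal (heat h f x)) \<partial>lborel)"
      by (subst emeasure_density) (auto intro!: nn_integral_cong simp: mult_ac)
    also have "\<dots> = (\<integral>\<^sup>+x. ?d x * (\<integral>\<^sup>+y. ennreal (normal_density 0 (sqrt h) y) * (indicator B x * ennreal (f (x + y))) \<partial>lborel) \<partial>lborel)"
      unfolding heat_f_nn_integral[OF h, symmetric]
      by (intro nn_integral_cong) (simp add: nn_integral_cmult[symmetric] mult_ac)
    also have "\<dots> = (\<integral>\<^sup>+\<omega>. indicator B (W s \<omega>) * ennreal (f (W (s + h) \<omega>)) \<partial>M)"
      using nn_integral_W_increment[OF s h, of "\<lambda>p. indicator B (fst p) * ennreal (f (fst p + snd p))"] by simp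
    also have "\<dots> = (\<integral>\<^sup>+\<omega>. indicator B (W s \<omega>) * ennreal (r * f (W s \<omega>)) \<partial>M)"
      unfolding r_def by (rule martingale_nn_integral[OF s h]) simp
    also have "\<dots> = (\<integral>\<^sup>+x. ?d x * (indicator B x * ennreal (r * f x)) \<partial>lborel)"
      by (rule distributed_nn_integral[OF distributed_W[OF s], symmetric]) simp
    also have "\<dots> = emeasure (density lborel (\<lambda>x. ?d x * ennreal (r * f x))) B"
      by (subst emeasure_density) (auto intro!: nn_integral_cong simp: mult_ac)
    finally show "emeasure (density lborel (\<lambda>x. ?d x * ennreal (heat h f x))) B =
        emeasure (density lborel (\<lambda>x. ?d x * ennreal (r * f x))) B" .
  qed simp
  then have "AE x in lborel. ?d x * ennreal (heat h f x) = ?d x * ennreal (r * f x)"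
    by (intro sigma_finite_measure.density_unique[OF lborel.sigma_finite_measure_axioms]) auto
  then show ?thesis
  proof eventually_elim
    fix x assume eq: "?d x * ennreal (heat h f x) = ?d x * ennreal (r * f x)"
    have d: "0 < normal_density 0 (sqrt s) x" using s by (intro normal_density_pos) simp
    have nonneg: "0 \<le> heat h f x" unfolding heat_def
      by (intro integral_nonneg_AE AE_I2 mult_nonneg_nonneg normal_density_nonneg less_imp_le[OF f_pos])
    have "0 \<le> r * f x" using r f_pos[of x] by simp
    with eq nonneg d have "normal_density 0 (sqrt s) x * heat h f x = normal_density 0 (sqrt s) x * (r * f x)"
      by (simp only: flip: ennreal_mult) (simp add: ennreal_inj)
    then show "heat h f x = m (s + h) / m s * f x" unfolding r_def[symmetric] using d by simp
  qed
qed

text \<open>The function \<open>heat h f\<close> does not involve s, so neither does its ratio to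
  the nowhere vanishing f.\<close>

lemma m_ratio:
  assumes "0 < s" "0 < s'" "0 < h"
  shows "m (s + h) / m s = m (s' + h) / m s'"
proof -
  have "AE x in lborel. m (s + h) / m s * f x = m (s' + h) / m s' * f x"
    using AE_heat_f[OF assms(1,3)] AE_heat_f[OF assms(2,3)] by eventually_elim simp
  then have "AE x::real in lborel. m (s + h) / m s = m (s' + h) / m s'"
    by eventually_elim (metis f_pos less_irrefl mult_right_cancel)
  then show ?thesis by (auto simp: AE_iff_null null_sets_def split: if_splits)
qed

text \<open>The eigenvalue of \<open>heat h\<close> at f; by \<open>m_ratio\<close> the base time 1
  is an arbitrary choice.\<close>

definition growth :: "real \<Rightarrow> real" where
  "growth h = m (1 + h) / m 1"

lemma growth_pos: "0 < h \<Longrightarrow> 0 < growth h"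
  by (simp add: growth_def m_pos)

lemma growth_eq: "0 < s \<Longrightarrow> 0 < h \<Longrightarrow> m (s + h) = growth h * m s"
  using m_ratio[of s 1 h] m_pos[of s] by (simp add: growth_def field_simps)

lemma growth_double:
  assumes "0 < h" shows "growth (2 * h) = (growth h)\<^sup>2"
proof -
  have "growth (2 * h) * m 1 = m (1 + h + h)" using growth_eq[of 1 "2 * h"] assms by (simp add: add.assoc)
  also have "\<dots> = growth h * (growth h * m 1)" using growth_eq[of 1 h] growth_eq[of "1 + h" h] assms by simp
  finally show ?thesis using m_pos[of 1] by (simp add: power2_eq_square)
qed

text \<open>An eigenvalue below 1 would make m(n) decay geometrically. But the Gaussian density of
  variance n is at least that of variance 1 divided by sqrt n, so for f > 0 the decay is at most of
  order 1/sqrt n.\<close>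

lemma growth_1_ge: "1 \<le> growth 1"
proof (rule ccontr)
  assume "\<not> 1 \<le> growth 1"
  then have c: "0 < growth 1" "growth 1 < 1" using growth_pos[of 1] by auto
  define a where "a = - ln (growth 1)"
  have a: "0 < a" using c by (simp add: a_def)
  have "m 1 * (1 / sqrt (real (Suc n))) \<le> m 1 * exp (- a * real n)" for n
  proof -
    have "m (real (Suc n)) = growth 1 ^ n * m 1"
    proof (induction n)
      case (Suc n)
      then show ?case using growth_eq[of "real (Suc n)" 1] by (simp add: add_ac)
    qed simp
    also have "growth 1 ^ n = exp (- a * real n)"
      using c by (simp add: a_def exp_of_nat_mult[symmetric] mult.commute exp_of_nat2_mult[symmetric] powr_realpow[symmetric] powr_def)
    finally have 1: "m (real (Suc n)) = m 1 * exp (- a * real n)" by (simp add: mult.commute)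
    have "m 1 * (1 / sqrt (real (Suc n))) = (\<integral>y. normal_density 0 (sqrt 1) y * f y * (1 / sqrt (real (Suc n))) \<partial>lborel)"
      using m_eq_heat[of 1] by (simp add: heat_def)
    also have "\<dots> \<le> (\<integral>y. normal_density 0 (sqrt (real (Suc n))) y * f y \<partial>lborel)"
    proof (rule integral_mono)
      show "integrable lborel (\<lambda>y. normal_density 0 (sqrt 1) y * f y * (1 / sqrt (real (Suc n))))"
        by (intro integrable_mult_left integrable_normal_f) simp
      show "integrable lborel (\<lambda>y. normal_density 0 (sqrt (real (Suc n))) y * f y)"
        by (intro integrable_normal_f) simp
      fix y
      have "- y\<^sup>2 / 2 \<le> - y\<^sup>2 / (2 * real (Suc n))" by (simp add: field_simps)
      then have "1 / sqrt (2 * pi) * exp (- y\<^sup>2 / 2) * (1 / sqrt (real (Suc n))) \<le>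
          1 / sqrt (2 * pi) * exp (- y\<^sup>2 / (2 * real (Suc n))) * (1 / sqrt (real (Suc n)))"
        by (intro mult_right_mono mult_left_mono) auto
      also have "\<dots> = normal_density 0 (sqrt (real (Suc n))) y"
        by (simp add: normal_density_def real_sqrt_mult del: of_nat_Suc)
      finally have "normal_density 0 (sqrt 1) y * (1 / sqrt (real (Suc n))) \<le> normal_density 0 (sqrt (real (Suc n))) y"
        by (simp add: normal_density_def)
      then show "normal_density 0 (sqrt 1) y * f y * (1 / sqrt (real (Suc n))) \<le> normal_density 0 (sqrt (real (Suc n))) y * f y"
        using mult_right_mono[OF _ less_imp_le[OF f_pos[of y]]] by (metis mult.assoc mult.commute)
    qed
    also have "\<dots> = m (real (Suc n))" using m_eq_heat[of "real (Suc n)"] by (simp add: heat_def)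
    finally show ?thesis unfolding 1 .
  qed
  then have le: "1 \<le> exp (- a * real n) * sqrt (real (Suc n))" for n
    using m_pos[of 1] by (simp add: field_simps)
  have "(\<lambda>n. exp (- a * real n) * sqrt (real (Suc n))) \<longlonglongrightarrow> 0" using a by real_asymp
  then have "1 \<le> (0::real)" using le by (intro LIMSEQ_le_const) auto
  then show False by simp
qed

lemma eq_cosh: "\<exists>c. \<forall>x. f x = cosh (c * x)"
proof -
  \<comment> \<open>Solves \<open>growth 1 = exp (c^2 / 2)\<close>, the eigenvalue of cosh(cx) at
    time 1; the logarithm is nonnegative by \<open>growth_1_ge\<close>.\<close>
  define c where "c = sqrt (2 * ln (growth 1))"
  have c2: "c\<^sup>2 / 2 = ln (growth 1)" using growth_1_ge by (simp add: c_def)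
  have growth: "growth (1 / 2 ^ k) = exp (c\<^sup>2 / 2 / 2 ^ k)" for k
  proof (induction k)
    case 0
    then show ?case using growth_pos[of 1] by (simp add: c2)
  next
    case (Suc k)
    have "(growth (1 / 2 ^ Suc k))\<^sup>2 = growth (1 / 2 ^ k)"
      using growth_double[of "1 / 2 ^ Suc k"] by simp
    also have "\<dots> = (exp (c\<^sup>2 / 2 / 2 ^ Suc k))\<^sup>2"
      unfolding Suc power2_eq_square mult_exp_exp by (simp add: field_simps)
    finally show ?case
      by (rule power2_eq_imp_eq) (use growth_pos[of "1 / 2 ^ Suc k"] in simp_all)
  qed
  \<comment> \<open>Smoothing f for unit time and dividing by the eigenvalue returns f almost
    everywhere, now in a continuous version.\<close>
  define g where "g x = heat 1 f x / growth 1" for x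
  have g_cont: "continuous_on UNIV g"
    unfolding g_def using growth_pos[of 1] by (intro continuous_intros continuous_on_heat_f) auto
  then have [measurable]: "g \<in> borel_measurable borel" by (rule borel_measurable_continuous_onI)
  have fg: "AE x in lborel. f x = g x"
    using AE_heat_f[of 1 1] growth_pos[of 1] by (auto simp: g_def growth_def)
  have heat_fg: "heat h f x = heat h g x" for h x
    unfolding heat_def using fg by (intro integral_cong_AE) auto
  have g_int: "integrable lborel (\<lambda>y. normal_density x (sqrt h) y * g y)" if "0 < h" for x h
  proof -
    have "AE y in lborel. normal_density x (sqrt h) y * g y = normal_density x (sqrt h) y * f y"
      using fg by eventually_elim simp
    then show ?thesis
      using integrable_heat_f[OF _ that, of x] by (subst integrable_cong_AE) auto
  qed
  have g_even: "g (- x) = g x" for x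
  proof -
    have "heat 1 f (- x) = (\<integral>y. normal_density (- x) (sqrt 1) (0 + (- 1) * y) * f (0 + (- 1) * y) \<partial>lborel)"
      unfolding heat_def by (subst lborel_integral_real_affine[of "- 1" _ 0]) auto
    also have "\<dots> = heat 1 f x"
      unfolding heat_def normal_density_def
      by (intro Bochner_Integration.integral_cong) (auto simp: f_even power2_commute add.commute)
    finally show ?thesis by (simp add: g_def)
  qed
  have "heat (1 / 2 ^ k) g x = exp (c\<^sup>2 / 2 / 2 ^ k) * g x" for x k
  proof (rule continuous_AE_eq[of "heat (1 / 2 ^ k) g"])
    show "continuous_on UNIV (heat (1 / 2 ^ k) g)" by (intro continuous_on_heat g_int) auto
    show "continuous_on UNIV (\<lambda>x. exp (c\<^sup>2 / 2 / 2 ^ k) * g x)" by (intro continuous_intros g_cont)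
    have "AE x in lborel. heat (1 / 2 ^ k) f x = exp (c\<^sup>2 / 2 / 2 ^ k) * f x"
      using AE_heat_f[of 1 "1 / 2 ^ k"] unfolding growth_def[symmetric] growth by simp
    with fg show "AE x in lborel. heat (1 / 2 ^ k) g x = exp (c\<^sup>2 / 2 / 2 ^ k) * g x"
      by eventually_elim (simp add: heat_fg)
  qed
  then have g_cosh: "g x = g 0 * cosh (c * x)" for x
    by (intro heat_eigenfunction_eq_cosh g_cont g_even g_int)
  \<comment> \<open>This makes m continuous at positive times, so that the normalising factor can be
    followed to the limit below.\<close>
  have m_eq: "m t = g 0 * exp (c\<^sup>2 * t / 2)" if "0 < t" for t
  proof -
    have "heat t g 0 = (\<integral>y. g 0 * (normal_density 0 (sqrt t) y * cosh (c * y)) \<partial>lborel)"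
      unfolding heat_def by (subst g_cosh) (simp add: mult_ac)
    also have "\<dots> = g 0 * exp (c\<^sup>2 * t / 2)"
      using has_bochner_integral_heat_cosh[OF that, of 0 c] by (simp add: has_bochner_integral_iff)
    finally show ?thesis using m_eq_heat[OF that] heat_fg by simp
  qed
  have "f x = g x" for x
  proof -
    \<comment> \<open>At each fixed positive time the law of W has a density and does not charge the
      exceptional set; countably many times can be treated at once.\<close>
    have "AE \<omega> in M. \<forall>q\<in>\<rat>. 0 < q \<longrightarrow> f (W q \<omega>) = g (W q \<omega>)"
    proof (rule AE_ball_countable[THEN iffD2, OF countable_rat], rule ballI)
      fix q :: real
      show "AE \<omega> in M. 0 < q \<longrightarrow> f (W q \<omega>) = g (W q \<omega>)"
      proof (cases "0 < q")
        case True
        have "AE x in density lborel (\<lambda>x. ennreal (normal_density 0 (sqrt q) x)). f x = g x"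
          using fg by (subst AE_density) auto
        then have "AE x in distr M lborel (W q). f x = g x"
          unfolding distributed_distr_eq_density[OF distributed_W[OF True]] .
        then show ?thesis using True by (subst (asm) AE_distr_iff) auto
      qed simp
    qed
    then have "AE \<omega> in M. continuous_on {0..} (\<lambda>t. W t \<omega>) \<and> (\<forall>q\<in>\<rat>. 0 < q \<longrightarrow> f (W q \<omega>) = g (W q \<omega>)) \<and>
        (\<forall>t\<ge>0. continuous (at_right t) (\<lambda>s. f (W s \<omega>) / m s))"
      using AE_continuous f_right_continuous unfolding right_continuous_process_def m_def
      by eventually_elim blast
    then obtain G where G: "G \<in> events" "prob G = 1"
      and "\<And>\<omega>. \<omega> \<in> G \<Longrightarrow> continuous_on {0..} (\<lambda>t. W t \<omega>) \<and> (\<forall>q\<in>\<rat>. 0 < q \<longrightarrow> f (W q \<omega>) = g (W q \<omega>)) \<and>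
        (\<forall>t\<ge>0. continuous (at_right t) (\<lambda>s. f (W s \<omega>) / m s))"
      by (rule AE_E_prob) auto
    then have cont: "\<And>\<omega>. \<omega> \<in> G \<Longrightarrow> continuous_on {0..} (\<lambda>t. W t \<omega>)"
      and rat: "\<And>\<omega> q. \<omega> \<in> G \<Longrightarrow> q \<in> \<rat> \<Longrightarrow> 0 < q \<Longrightarrow> f (W q \<omega>) = g (W q \<omega>)"
      and rc: "\<And>\<omega> t. \<omega> \<in> G \<Longrightarrow> 0 \<le> t \<Longrightarrow> continuous (at_right t) (\<lambda>s. f (W s \<omega>) / m s)" by blast+
    \<comment> \<open>Only the first path of the chain is used: a good path passing exactly through
      x.\<close>
    obtain V where V: "V \<in> sets M4" "0 < measure M4 V" "V \<subseteq> G \<times> ((G \<times> G) \<times> G)" "\<And>\<omega>. \<omega> \<in> V \<Longrightarrow> chain x \<omega>"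
      using chain_positive_on[OF G cont] by blast
    then have "V \<noteq> {}" by auto
    then obtain \<omega> where "\<omega> \<in> V" by auto
    with V(3) V(4)[of \<omega>] have "fst \<omega> \<in> G" "\<exists>t\<in>{1..2}. W t (fst \<omega>) = x"
      by (auto simp: chain_def)
    then obtain \<omega>1 t where \<omega>1: "\<omega>1 \<in> G" and t: "1 \<le> t" "W t \<omega>1 = x" by auto
    \<comment> \<open>At rational times strictly after t the path sees g. Right-continuity of N at t
      evaluates the same limit as f(x)/m(t), although f is not yet known to be continuous.\<close>
    have "\<exists>q. q \<in> \<rat> \<and> t < q \<and> q < t + 1 / real (Suc n)" for n
      using Rats_dense_in_real[of t "t + 1 / real (Suc n)"] by auto
    then obtain q where q: "\<And>n. q n \<in> \<rat>" "\<And>n. t < q n" "\<And>n. q n < t + 1 / real (Suc n)"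
      by metis
    have q_lim: "q \<longlonglongrightarrow> t"
    proof (rule tendsto_sandwich[of "\<lambda>_. t" q sequentially "\<lambda>n. t + 1 / real (Suc n)"])
      show "(\<lambda>n. t + 1 / real (Suc n)) \<longlonglongrightarrow> t" by real_asymp
    qed (use q in \<open>auto intro!: always_eventually intro: less_imp_le\<close>)
    then have "filterlim q (at_right t) sequentially"
      using q less_imp_neq[OF q(2), symmetric] by (auto simp: filterlim_at intro!: always_eventually)
    with rc[OF \<omega>1, of t] t have "(\<lambda>n. f (W (q n) \<omega>1) / m (q n)) \<longlonglongrightarrow> f x / m t"
      unfolding continuous_within by (auto intro: filterlim_compose)
    moreover have "(\<lambda>n. f (W (q n) \<omega>1) / m (q n)) \<longlonglongrightarrow> g x / m t"
    proof -
      have qpos: "0 < q n" for n using q(2)[of n] t by simp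
      have W: "(\<lambda>n. W (q n) \<omega>1) \<longlonglongrightarrow> x"
        using continuous_on_tendsto_compose[OF cont[OF \<omega>1] q_lim] t always_eventually[of "\<lambda>n. 0 \<le> q n" sequentially]
          less_imp_le[OF qpos] by simp
      have g: "(\<lambda>n. g (W (q n) \<omega>1)) \<longlonglongrightarrow> g x"
        using continuous_on_tendsto_compose[OF g_cont W] by simp
      have m: "(\<lambda>n. m (q n)) \<longlonglongrightarrow> m t"
        using t qpos by (subst (1 2) m_eq) (auto intro!: tendsto_intros q_lim)
      show ?thesis
        using tendsto_divide[OF g m] m_pos[of t] t rat[OF \<omega>1 q(1) qpos] by simp
    qed
    ultimately have "f x / m t = g x / m t" by (rule LIMSEQ_unique)
    then show ?thesis using m_pos[of t] t by simp
  qed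
  then show ?thesis using f_0 g_cosh by (intro exI[of _ c]) (metis mult_1)
qed

end

theorem theorem4:
  fixes M :: "'a measure" and W :: "real \<Rightarrow> 'a \<Rightarrow> real" and f :: "real \<Rightarrow> real"
  assumes "prob_space M"
    and "complete_space_measure M"
    and "brownian_motion M W"
  defines "N \<equiv> (\<lambda>t \<omega>. f (W t \<omega>) / (\<integral>\<omega>'. f (W t \<omega>') \<partial>M))"
  shows
    "((f \<in> borel_measurable borel \<and> (\<forall>x. 0 < f x) \<and>
        (\<forall>x y. f (x + y) + f (x - y) = 2 * f x * f y))
      \<longleftrightarrow>
      ((\<forall>x. 0 < f x) \<and> (\<forall>x. f (- x) = f x) \<and> f 0 = 1 \<and>
        (\<forall>t\<ge>0. integrable M (\<lambda>\<omega>. f (W t \<omega>))) \<and>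
        martingale M (natural_filtration M W) N \<and>
        right_continuous_process M N))
   \<and>
    ((f \<in> borel_measurable borel \<and> (\<forall>x. 0 < f x) \<and>
        (\<forall>x y. f (x + y) + f (x - y) = 2 * f x * f y))
      \<longleftrightarrow>
      (\<exists>c::real. \<forall>x. f x = cosh (c * x)))"
    (is "(?i \<longleftrightarrow> ?ii) \<and> (?i \<longleftrightarrow> ?iii)")
proof -
  interpret brownian M W
    using assms by (simp add: brownian_def brownian_axioms_def)
  have "?ii" if iii: ?iii
  proof -
    obtain c where "\<forall>x. f x = cosh (c * x)" using iii by blast
    then have f: "f = (\<lambda>x. cosh (c * x))" by auto
    show ?thesis
      unfolding N_def f
      by (auto simp: martingale_cosh right_continuous_cosh integrable_cosh_W)
  qed
  moreover have "?iii" if ii: ?ii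
  proof -
    have pos: "0 < (\<integral>\<omega>. f (W t \<omega>) \<partial>M)" if "0 \<le> t" for t
      using ii that by (intro expectation_greater) auto
    have "N t \<in> borel_measurable M" if "0 \<le> t" for t
      using ii that by (auto simp: martingale_def)
    \<comment> \<open>This has to come first: \<open>even_martingale\<close> presupposes a Borel f,
      so that its Gaussian integrals make sense.\<close>
    then have "f \<in> borel_measurable borel"
      using ii pos unfolding N_def
      by (intro borel_measurable_of_right_continuous[of f "\<lambda>t. \<integral>\<omega>. f (W t \<omega>) \<partial>M"])
        (auto simp: less_imp_neq[symmetric])
    then interpret even_martingale M W f
      using ii unfolding N_def by unfold_locales auto
    show ?thesis by (rule eq_cosh)
  qed
  moreover have "?i \<longleftrightarrow> ?iii" by (rule dalembert_iff_cosh)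
  ultimately show ?thesis by blast
qed

end
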